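(* Let $G$ be a group acting on the left, by homeomorphisms, on a topological space $X$. The following conditions are equivalent. (i) $G$ contains a free subgroup $F$ of rank 2 such that there exists a nonempty, open, $F$-invariant subspace $Z \subseteq X$ on which $F$ acts properly discontinuously. (ii) There exist nonempty, open subsets $A$ and $Y$ of $X$, with $A \subseteq Y \subseteq X$, and elements $a,a_0,a_1,a_2$ in $G$ such that $Y = A \cup aA$; the sets $a_0A$, $a_1A$, $a_2A$ are pairwise disjoint; and $Y$ is invariant under each of $a,a_0,a_1,a_2$. (iii) There exist nonempty, open subsets $A$ and $Y$ of $X$, with $A \subseteq Y \subseteq X$, such that, for every integer $n \geq 3$, there exist elements $a,a_0,a_1,\dots,a_{n-1}$ in $G$ such that $Y = A \cup aA$; the sets $a_0A,a_1A,\dots,a_{n-1}A$ are pairwise disjoint; and $Y$ is invariant under each of $a,a_0,a_1,\dots,a_{n-1}$. (iv) There are elements $f_1$ and $f_2$ in $G$ and nonempty, open, pairwise disjoint subsets $U_0,U_1^+,U_1^-,U_2^+,U_2^-$ of $X$ such that $$f_1(U_0 \cup U_1^+ \cup U_2^+ \cup U_2^-) \subseteq U_1^+, \qquad f_1^{-1}(U_0 \cup U_1^- \cup U_2^+ \cup U_2^-) \subseteq U_1^-,$$ $$f_2(U_0 \cup U_2^+ \cup U_1^+ \cup U_1^-) \subseteq U_2^+, \qquad f_2^{-1}(U_0 \cup U_2^- \cup U_1^+ \cup U_1^-) \subseteq U_2^-.$$ Moreover, for an integer $n \ge 3$, say that $(A,Y;a,a_0,\dots,a_{n-1})$ is an $n$-system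 if $A \subseteq Y \subseteq X$ are nonempty open subsets of $X$ and $a,a_0,\dots,a_{n-1} \in G$ are such that $Y = A \cup aA$, the sets $a_0A,\dots,a_{n-1}A$ are pairwise disjoint, and $Y$ is invariant under each of $a,a_0,\dots,a_{n-1}$. Then: (1) if $(A,Y;a,a_0,a_1,a_2)$ is a $3$-system, then $[a,a_1^{-1}a_0]$ and $[a,a_2^{-1}a_0]$ freely generate a free group of rank 2; (2) if $(A,Y;a,a_0,a_1,a_2,a_3)$ is a $4$-system, then $a_0aa_1^{-1}$ and $a_2aa_3^{-1}$ freely generate a free group of rank 2; (3) if $k \geq 2$, $n \geq 2k+1$, and $(A,Y;a,a_0,\dots,a_{n-1})$ is an $n$-system, then $F=\langle a_1aa_2^{-1}, a_3aa_4^{-1}, \dots,a_{2k-1}aa_{2k}^{-1} \rangle$ is a free group of rank $k$ acting properly discontinuously on the open, $F$-invariant subspace $Fa_0A$ of $X$; (4) if $(A,Y;a,a_0,a_1,a_2,a_3,a_4)$ is a $5$-system, then (iv) holds with $f_1=a_1aa_2^{-1}$, $f_2=a_3aa_4^{-1}$, $U_0=a_0A$, $U_1^+=a_1A$, $U_1^-=a_2A$, $U_2^+=a_3A$, and $U_2^-=a_4A$.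
   Context: For $h \in G$ and $S \subseteq X$, $hS=\{hs \mid s\in S\}$; for $H \subseteq G$, $HS = \bigcup_{h\in H} hS$. A subset $Y \subseteq X$ is invariant under an element $h$ (respectively a subgroup $H$) if $hY = Y$ (respectively $HY=Y$); invariance means equality, not just inclusion. A properly discontinuous action of a group $H$ on a topological space $Z$ is an action of $H$ on $Z$ by homeomorphisms such that every point $z \in Z$ has an open neighborhood $U_z$ with $hU_z \cap U_z = \emptyset$ for all $h \in H$, $h \neq 1$. Commutators are $[x,y]=x^{-1}y^{-1}xy$. *)

theory Defs
  imports
    "HOL-Analysis.Analysis"
    "HOL-Algebra.Group_Action"
    "HOL-Algebra.Generated_Groups"
begin

section \<open>Free groups\<close>

text \<open>
  The free group on a set \<open>I\<close> is the set of words in the letters \<open>(i, True)\<close>, standing for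
  \<open>i\<close>, and \<open>(i, False)\<close>, standing for the inverse of \<open>i\<close>, modulo insertion and deletion of
  adjacent mutually inverse letters.
\<close>

abbreviation words :: "'i set \<Rightarrow> ('i \<times> bool) list set"
  where "words I \<equiv> lists (I \<times> UNIV)"

inductive_set free_cong :: "'i set \<Rightarrow> (('i \<times> bool) list \<times> ('i \<times> bool) list) set"
  for I :: "'i set" where
  cancel: "u \<in> words I \<Longrightarrow> v \<in> words I \<Longrightarrow> i \<in> I \<Longrightarrow>
      (u @ [(i, b), (i, \<not> b)] @ v, u @ v) \<in> free_cong I"
| refl: "u \<in> words I \<Longrightarrow> (u, u) \<in> free_cong I"
| sym: "(u, v) \<in> free_cong I \<Longrightarrow> (v, u) \<in> free_cong I"
| trans: "(u, v) \<in> free_cong I \<Longrightarrow> (v, w) \<in> free_cong I \<Longrightarrow> (u, w) \<in> free_cong I"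

definition free_group :: "'i set \<Rightarrow> ('i \<times> bool) list set monoid"
  where "free_group I =
    \<lparr>carrier = words I // free_cong I,
     mult = (\<lambda>A B. \<Union>u\<in>A. \<Union>v\<in>B. free_cong I `` {u @ v}),
     one = free_cong I `` {[]}\<rparr>"

definition free_gen :: "'i set \<Rightarrow> 'i \<Rightarrow> ('i \<times> bool) list set"
  where "free_gen I i = free_cong I `` {[(i, True)]}"

definition free_of_rank :: "('g, 'm) monoid_scheme \<Rightarrow> nat \<Rightarrow> bool"
  where "free_of_rank H k \<longleftrightarrow> free_group {..<k} \<cong> H"

definition freely_generates :: "('g, 'm) monoid_scheme \<Rightarrow> 'g set \<Rightarrow> bool"
  where "freely_generates G S \<longleftrightarrow> S \<subseteq> carrier G \<and>
    (\<exists>h \<in> iso (free_group S) (G\<lparr>carrier := generate G S\<rparr>). \<forall>s\<in>S. h (free_gen S s) = s)"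

lemma free_cong_words:
  assumes "(u, v) \<in> free_cong I"
  shows "u \<in> words I" and "v \<in> words I"
  using assms by (induction rule: free_cong.induct) simp_all

lemma equiv_free_cong: "equiv (words I) (free_cong I)"
proof (rule equivI)
  show "free_cong I \<subseteq> words I \<times> words I"
  proof
    fix p assume "p \<in> free_cong I"
    then show "p \<in> words I \<times> words I"
      using free_cong_words[of "fst p" "snd p" I] by (simp add: mem_Times_iff)
  qed
  show "refl_on (words I) (free_cong I)"
    by (simp add: refl_on_def free_cong.refl)
  show "sym (free_cong I)"
    by (rule symI) (rule free_cong.sym)
  show "trans (free_cong I)"
    by (rule transI) (rule free_cong.trans)
qed

lemma free_cong_context:
  assumes "(u, v) \<in> free_cong I" "p \<in> words I" "q \<in> words I"
  shows "(p @ u @ q, p @ v @ q) \<in> free_cong I"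
  using assms(1)
proof (induction rule: free_cong.induct)
  case (cancel u v i b)
  then show ?case
    using free_cong.cancel[of "p @ u" I "v @ q" i b] assms(2,3) by simp
next
  case (refl u)
  then show ?case
    using assms(2,3) by (simp add: free_cong.refl)
next
  case (sym u v)
  show ?case by (rule free_cong.sym) (rule sym.IH)
next
  case (trans u v w)
  show ?case by (rule free_cong.trans) (rule trans.IH)+
qed

lemma free_cong_append:
  assumes "(u, u') \<in> free_cong I" "(v, v') \<in> free_cong I"
  shows "(u @ v, u' @ v') \<in> free_cong I"
proof -
  have "(u @ v, u' @ v) \<in> free_cong I"
    using free_cong_context[OF assms(1), of "[]" v] free_cong_words[OF assms(2)] by simp
  moreover have "(u' @ v, u' @ v') \<in> free_cong I"
    using free_cong_context[OF assms(2), of u' "[]"] free_cong_words[OF assms(1)] by simp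
  ultimately show ?thesis by (rule free_cong.trans)
qed

lemma free_group_mult:
  assumes "u \<in> words I" "v \<in> words I"
  shows "free_cong I `` {u} \<otimes>\<^bsub>free_group I\<^esub> free_cong I `` {v} = free_cong I `` {u @ v}"
proof -
  have "free_cong I `` {u' @ v'} = free_cong I `` {u @ v}"
    if "(u, u') \<in> free_cong I" "(v, v') \<in> free_cong I" for u' v'
    using equiv_class_eq[OF equiv_free_cong free_cong_append[OF that]] by (rule HOL.sym)
  then have "(\<Union>u'\<in>free_cong I `` {u}. \<Union>v'\<in>free_cong I `` {v}. free_cong I `` {u' @ v'}) =
      (\<Union>u'\<in>free_cong I `` {u}. \<Union>v'\<in>free_cong I `` {v}. free_cong I `` {u @ v})"
    by (intro SUP_cong HOL.refl) blast
  also have "\<dots> = free_cong I `` {u @ v}"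
    using free_cong.refl[OF assms(1)] free_cong.refl[OF assms(2)] by blast
  finally show ?thesis
    by (simp only: free_group_def monoid.simps)
qed

lemma free_group_carrierE:
  assumes "x \<in> carrier (free_group I)"
  obtains u where "u \<in> words I" "x = free_cong I `` {u}"
  using assms that unfolding free_group_def partial_object.simps by (rule quotientE)

lemma free_group_carrierI: "u \<in> words I \<Longrightarrow> free_cong I `` {u} \<in> carrier (free_group I)"
  by (simp add: free_group_def quotientI)

lemma free_cong_inverse:
  assumes "u \<in> words I"
  shows "(map (apsnd Not) (rev u) @ u, []) \<in> free_cong I"
  using assms
proof (induction u rule: list.induct)
  case Nil
  then show ?case by (simp add: free_cong.refl)
next
  case (Cons y u)
  obtain i b where x: "y = (i, b)" by (cases y)
  have u: "u \<in> words I" and i: "i \<in> I"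
    using Cons.prems by (simp_all add: x)
  have "map (apsnd Not) (rev u) \<in> words I"
    using u by (auto simp: in_lists_conv_set)
  then have "(map (apsnd Not) (rev u) @ [(i, \<not> b), (i, \<not> \<not> b)] @ u,
      map (apsnd Not) (rev u) @ u) \<in> free_cong I"
    using u i by (rule free_cong.cancel)
  moreover have "(map (apsnd Not) (rev u) @ u, []) \<in> free_cong I"
    using Cons.IH u by blast
  ultimately have "(map (apsnd Not) (rev u) @ [(i, \<not> b), (i, \<not> \<not> b)] @ u, []) \<in> free_cong I"
    by (rule free_cong.trans)
  then show ?case
    by (simp add: x)
qed

lemma group_free_group: "group (free_group I)"
proof (rule groupI)
  have one: "\<one>\<^bsub>free_group I\<^esub> = free_cong I `` {[]}"
    by (simp add: free_group_def)
  show "\<one>\<^bsub>free_group I\<^esub> \<in> carrier (free_group I)"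
    unfolding one by (rule free_group_carrierI) simp
  fix x assume "x \<in> carrier (free_group I)"
  then obtain u where u: "u \<in> words I" "x = free_cong I `` {u}"
    by (rule free_group_carrierE)
  show "\<one>\<^bsub>free_group I\<^esub> \<otimes>\<^bsub>free_group I\<^esub> x = x"
    using free_group_mult[of "[]" I u] u by (simp add: one)
  have inv: "map (apsnd Not) (rev u) \<in> words I"
    using u(1) by (auto simp: in_lists_conv_set)
  show "\<exists>y\<in>carrier (free_group I). y \<otimes>\<^bsub>free_group I\<^esub> x = \<one>\<^bsub>free_group I\<^esub>"
    unfolding one u(2)
  proof (rule bexI)
    show "free_cong I `` {map (apsnd Not) (rev u)} \<otimes>\<^bsub>free_group I\<^esub> free_cong I `` {u} =
        free_cong I `` {[]}"
      unfolding free_group_mult[OF inv u(1)]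
      using equiv_free_cong free_cong_inverse[OF u(1)] by (rule equiv_class_eq)
  qed (rule free_group_carrierI[OF inv])
  fix y assume "y \<in> carrier (free_group I)"
  then obtain v where v: "v \<in> words I" "y = free_cong I `` {v}"
    by (rule free_group_carrierE)
  have uv: "u @ v \<in> words I" using u v by simp
  show "x \<otimes>\<^bsub>free_group I\<^esub> y \<in> carrier (free_group I)"
    unfolding u(2) v(2) free_group_mult[OF u(1) v(1)] by (rule free_group_carrierI[OF uv])
  fix z assume "z \<in> carrier (free_group I)"
  then obtain w where w: "w \<in> words I" "z = free_cong I `` {w}"
    by (rule free_group_carrierE)
  have vw: "v @ w \<in> words I" using v w by simp
  show "x \<otimes>\<^bsub>free_group I\<^esub> y \<otimes>\<^bsub>free_group I\<^esub> z = x \<otimes>\<^bsub>free_group I\<^esub> (y \<otimes>\<^bsub>free_group I\<^esub> z)"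
    unfolding u(2) v(2) w(2) free_group_mult[OF u(1) v(1)] free_group_mult[OF v(1) w(1)]
      free_group_mult[OF uv w(1)] free_group_mult[OF u(1) vw] append_assoc by (rule HOL.refl)
qed


section \<open>Actions on topological spaces\<close>

text \<open>
  \<^locale>\<open>group_action\<close> requires each \<open>\<phi> g\<close> to be extensional, i.e. \<open>undefined\<close> outside the
  space acted on; this is why the action is restricted below when it is passed to an invariant
  subspace.
\<close>

definition acts_by_homeomorphisms ::
    "('g, 'm) monoid_scheme \<Rightarrow> 'x topology \<Rightarrow> ('g \<Rightarrow> 'x \<Rightarrow> 'x) \<Rightarrow> bool"
  where "acts_by_homeomorphisms G X \<phi> \<longleftrightarrow>
    group_action G (topspace X) \<phi> \<and> (\<forall>g\<in>carrier G. homeomorphic_map X X (\<phi> g))"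

definition translates :: "('g \<Rightarrow> 'x \<Rightarrow> 'x) \<Rightarrow> 'g set \<Rightarrow> 'x set \<Rightarrow> 'x set"
  where "translates \<phi> H S = (\<Union>h\<in>H. \<phi> h ` S)"

definition properly_discontinuous_action ::
    "('h, 'm) monoid_scheme \<Rightarrow> 'x topology \<Rightarrow> ('h \<Rightarrow> 'x \<Rightarrow> 'x) \<Rightarrow> bool"
  where "properly_discontinuous_action H Z \<psi> \<longleftrightarrow> acts_by_homeomorphisms H Z \<psi> \<and>
    (\<forall>z\<in>topspace Z. \<exists>U. openin Z U \<and> z \<in> U \<and>
      (\<forall>h\<in>carrier H. h \<noteq> \<one>\<^bsub>H\<^esub> \<longrightarrow> \<psi> h ` U \<inter> U = {}))"

definition properly_discontinuous_on ::
    "('g, 'm) monoid_scheme \<Rightarrow> 'x topology \<Rightarrow> ('g \<Rightarrow> 'x \<Rightarrow> 'x) \<Rightarrow> 'g set \<Rightarrow> 'x set \<Rightarrow> bool"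
  where "properly_discontinuous_on G X \<phi> F Z \<longleftrightarrow>
    properly_discontinuous_action (G\<lparr>carrier := F\<rparr>) (subtopology X Z) (\<lambda>f. restrict (\<phi> f) Z)"

definition commutator :: "('g, 'm) monoid_scheme \<Rightarrow> 'g \<Rightarrow> 'g \<Rightarrow> 'g"
  where "commutator G x y = inv\<^bsub>G\<^esub> x \<otimes>\<^bsub>G\<^esub> inv\<^bsub>G\<^esub> y \<otimes>\<^bsub>G\<^esub> x \<otimes>\<^bsub>G\<^esub> y"

text \<open>The elements \<open>a\<^sub>0, \<dots>, a\<^sub>n\<^sub>-\<^sub>1\<close> are the values of \<open>b\<close> at \<open>0, \<dots>, n - 1\<close>.\<close>

definition n_system ::
    "('g, 'm) monoid_scheme \<Rightarrow> 'x topology \<Rightarrow> ('g \<Rightarrow> 'x \<Rightarrow> 'x) \<Rightarrow> nat \<Rightarrow>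
      'x set \<Rightarrow> 'x set \<Rightarrow> 'g \<Rightarrow> (nat \<Rightarrow> 'g) \<Rightarrow> bool"
  where "n_system G X \<phi> n A Y a b \<longleftrightarrow>
    n \<ge> 3 \<and>
    openin X A \<and> A \<noteq> {} \<and> openin X Y \<and> Y \<noteq> {} \<and> A \<subseteq> Y \<and>
    a \<in> carrier G \<and> (\<forall>i<n. b i \<in> carrier G) \<and>
    Y = A \<union> \<phi> a ` A \<and>
    disjoint_family_on (\<lambda>i. \<phi> (b i) ` A) {..<n} \<and>
    \<phi> a ` Y = Y \<and> (\<forall>i<n. \<phi> (b i) ` Y = Y)"

text \<open>
  Disjointness is that of the five-element family, so that the sets are in particular distinct.
\<close>

definition ping_pong ::
    "('g, 'm) monoid_scheme \<Rightarrow> 'x topology \<Rightarrow> ('g \<Rightarrow> 'x \<Rightarrow> 'x) \<Rightarrow> 'g \<Rightarrow> 'g \<Rightarrow>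
      'x set \<Rightarrow> 'x set \<Rightarrow> 'x set \<Rightarrow> 'x set \<Rightarrow> 'x set \<Rightarrow> bool"
  where "ping_pong G X \<phi> f\<^sub>1 f\<^sub>2 U\<^sub>0 U1p U1m U2p U2m \<longleftrightarrow>
    f\<^sub>1 \<in> carrier G \<and> f\<^sub>2 \<in> carrier G \<and>
    (\<forall>U\<in>{U\<^sub>0, U1p, U1m, U2p, U2m}. openin X U \<and> U \<noteq> {}) \<and>
    disjoint_family_on ((!) [U\<^sub>0, U1p, U1m, U2p, U2m]) {..<5} \<and>
    \<phi> f\<^sub>1 ` (U\<^sub>0 \<union> U1p \<union> U2p \<union> U2m) \<subseteq> U1p \<and>
    \<phi> (inv\<^bsub>G\<^esub> f\<^sub>1) ` (U\<^sub>0 \<union> U1m \<union> U2p \<union> U2m) \<subseteq> U1m \<and>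
    \<phi> f\<^sub>2 ` (U\<^sub>0 \<union> U2p \<union> U1p \<union> U1m) \<subseteq> U2p \<and>
    \<phi> (inv\<^bsub>G\<^esub> f\<^sub>2) ` (U\<^sub>0 \<union> U2m \<union> U1p \<union> U1m) \<subseteq> U2m"

end

theory Submission
  imports Defs
begin

text \<open>
  Since \<open>a\<close> preserves \<open>Y = A \<union> aA\<close>, both \<open>a\<close> and its inverse map \<open>Y - A\<close> into \<open>A\<close>. Hence
  \<open>b\<^sub>i a b\<^sub>j\<inverse>\<close> maps \<open>Y - b\<^sub>jA\<close> into \<open>b\<^sub>iA\<close>, and its inverse maps \<open>Y - b\<^sub>iA\<close> into \<open>b\<^sub>jA\<close>, so such
  elements play ping-pong on the sets \<open>b\<^sub>iA\<close>. For a 3-system, put \<open>c\<^sub>i = b\<^sub>0\<inverse> b\<^sub>i\<close>; the commutators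
  \<open>a\<inverse> c\<^sub>i a c\<^sub>i\<inverse>\<close> play ping-pong on the sets \<open>a\<inverse> c\<^sub>iA \<subseteq> A\<close> and \<open>c\<^sub>iA \<subseteq> Y - A\<close>. With at least two
  generators no base point is needed for freeness: a reduced word \<open>w\<close> maps every ping-pong set other
  than that of the inverse of its last letter into that of its first letter, and among the four or more
  sets one is moved off itself. A base set \<open>U\<close> outside the ping-pong sets is moved off itself by
  every nontrivial element of \<open>F\<close>, so \<open>F\<close> acts properly discontinuously on \<open>FU\<close>.
\<close>


section \<open>Reduced words\<close>

abbreviation flip :: "'i \<times> bool \<Rightarrow> 'i \<times> bool"
  where "flip \<equiv> apsnd Not"

abbreviation reduced :: "('i \<times> bool) list \<Rightarrow> bool"
  where "reduced \<equiv> successively (\<lambda>x y. y \<noteq> flip x)"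

text \<open>Left multiplication by one letter on reduced words. Letting letters act in this way
  yields unique normal forms without a confluence argument (van der Waerden's trick).\<close>

definition push :: "'i \<times> bool \<Rightarrow> ('i \<times> bool) list \<Rightarrow> ('i \<times> bool) list"
  where "push x w = (if w \<noteq> [] \<and> hd w = flip x then tl w else x # w)"

definition norm_word :: "('i \<times> bool) list \<Rightarrow> ('i \<times> bool) list"
  where "norm_word w = foldr push w []"

lemma flip_flip [simp]: "flip (flip x) = x"
  by (cases x) simp

lemma reduced_push: "reduced w \<Longrightarrow> reduced (push x w)"
  by (cases w) (auto simp: push_def successively_Cons)

lemma reduced_foldr_push: "reduced w \<Longrightarrow> reduced (foldr push u w)"
  by (induction u) (simp_all add: reduced_push)

lemma reduced_norm_word: "reduced (norm_word u)"
  unfolding norm_word_def by (rule reduced_foldr_push) simp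

text \<open>If \<open>w\<close> starts with \<open>x\<close>, then \<open>push (flip x)\<close>
  deletes that letter, and reducedness keeps the rest from starting with \<open>flip x\<close>, so
  \<open>push x\<close> puts it back. Otherwise \<open>flip x\<close> is prepended and then
  cancelled.\<close>

lemma push_push_flip: "reduced w \<Longrightarrow> push x (push (flip x) w) = w"
  by (cases w) (auto simp: push_def successively_Cons)

lemma norm_word_Cons: "norm_word (x # w) = push x (norm_word w)"
  by (simp add: norm_word_def)

text \<open>A mutually inverse pair of letters acts trivially on reduced words, so congruent words
  carry the empty word to the same reduced word.\<close>

lemma norm_word_free_cong: "(u, v) \<in> free_cong I \<Longrightarrow> norm_word u = norm_word v"
proof (induction rule: free_cong.induct)
  case (cancel u v i b)
  have "push (i, b) (push (i, \<not> b) (norm_word v)) = norm_word v"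
    using push_push_flip[OF reduced_norm_word, of "(i, b)" v] by simp
  then show ?case
    by (simp add: norm_word_def)
qed simp_all

text \<open>Each \<open>push\<close> either prepends its letter or performs a single cancellation.
  Together with the invariance of \<open>norm_word\<close> this makes normal forms decide the
  congruence.\<close>

lemma free_cong_norm_word: "u \<in> words I \<Longrightarrow> (u, norm_word u) \<in> free_cong I"
proof (induction u)
  case Nil
  then show ?case by (simp add: norm_word_def free_cong.refl)
next
  case (Cons x u)
  have x: "[x] \<in> words I" and "u \<in> words I"
    using Cons.prems by auto
  then have IH: "(u, norm_word u) \<in> free_cong I"
    using Cons.IH by simp
  then have xu: "(x # u, x # norm_word u) \<in> free_cong I"
    using free_cong_append[OF free_cong.refl[OF x]] by simp
  show ?case
  proof (cases "norm_word u \<noteq> [] \<and> hd (norm_word u) = flip x")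
    case True
    then obtain w where w: "norm_word u = flip x # w"
      by (cases "norm_word u") auto
    then have "w \<in> words I"
      using free_cong_words(2)[OF IH] by simp
    then have "(x # flip x # w, w) \<in> free_cong I"
      using free_cong.cancel[of "[]" I w "fst x" "snd x"] x by (cases x) simp
    then show ?thesis
      using xu w by (auto simp: norm_word_Cons push_def intro: free_cong.trans)
  next
    case False
    then have "push x (norm_word u) = x # norm_word u"
      by (auto simp: push_def)
    then show ?thesis
      using xu by (simp add: norm_word_Cons)
  qed
qed

text \<open>The parity of the index reveals the sign of the letter, since \<open>p\<close> and
  \<open>q\<close> have opposite parities. Such indices distribute the letters over the translates
  of a system.\<close>

lemma inj_on_letter_index:
  assumes "odd (p + q)"
  shows "inj_on (\<lambda>x::nat \<times> bool. 2 * fst x + (if snd x then p else q)) S"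
proof (rule inj_onI)
  fix x y :: "nat \<times> bool"
  assume eq: "2 * fst x + (if snd x then p else q) = 2 * fst y + (if snd y then p else q)"
  have "even (2 * n + m) \<longleftrightarrow> even m" for n m :: nat by simp
  then have "even (if snd x then p else q) \<longleftrightarrow> even (if snd y then p else q)"
    using eq by metis
  then have "snd x = snd y"
    using assms by (simp split: if_splits)
  then show "x = y"
    using eq by (simp add: prod_eq_iff)
qed

text \<open>Nothing cancels inside a power of one letter, nor at the junction, where two letters of
  different index meet.\<close>

lemma norm_word_replicate:
  assumes "fst x \<noteq> fst (hd (norm_word w))"
  shows "norm_word (replicate n x @ w) = replicate n x @ norm_word w"
proof (induction n)
  case (Suc n)
  have "push x (replicate n x @ norm_word w) = x # replicate n x @ norm_word w"
    using assms by (cases n; cases x) (auto simp: push_def)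
  then show ?case
    using Suc by (simp add: norm_word_Cons)
qed simp

text \<open>The exponent is the length of the initial run of \<open>x\<close>, which ends exactly
  where \<open>u\<close> or \<open>v\<close> begins.\<close>

lemma replicate_append_eq_imp:
  assumes "replicate i x @ u = replicate j x @ v" "u \<noteq> []" "v \<noteq> []" "fst (hd u) \<noteq> fst x" "fst (hd v) \<noteq> fst x"
  shows "i = j"
  using assms
proof (induction i arbitrary: j)
  case 0
  then show ?case by (cases j) auto
next
  case (Suc i)
  then show ?case by (cases j) auto
qed


section \<open>Evaluation of words\<close>

definition letter_val :: "('g, 'm) monoid_scheme \<Rightarrow> ('i \<Rightarrow> 'g) \<Rightarrow> 'i \<times> bool \<Rightarrow> 'g"
  where "letter_val G f x = (if snd x then f (fst x) else inv\<^bsub>G\<^esub> f (fst x))"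

definition word_val :: "('g, 'm) monoid_scheme \<Rightarrow> ('i \<Rightarrow> 'g) \<Rightarrow> ('i \<times> bool) list \<Rightarrow> 'g"
  where "word_val G f w = foldr (\<lambda>x g. letter_val G f x \<otimes>\<^bsub>G\<^esub> g) w \<one>\<^bsub>G\<^esub>"

lemma word_val_Nil [simp]: "word_val G f [] = \<one>\<^bsub>G\<^esub>"
  and word_val_Cons [simp]: "word_val G f (x # w) = letter_val G f x \<otimes>\<^bsub>G\<^esub> word_val G f w"
  by (simp_all add: word_val_def)

context group
begin

lemma letter_val_closed: "f \<in> I \<rightarrow> carrier G \<Longrightarrow> x \<in> I \<times> UNIV \<Longrightarrow> letter_val G f x \<in> carrier G"
  by (auto simp: letter_val_def)

lemma letter_val_flip:
  assumes "f \<in> I \<rightarrow> carrier G" "x \<in> I \<times> UNIV"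
  shows "letter_val G f (flip x) = inv letter_val G f x"
  using assms by (cases x) (auto simp: letter_val_def Pi_iff)

lemma word_val_closed: "f \<in> I \<rightarrow> carrier G \<Longrightarrow> w \<in> words I \<Longrightarrow> word_val G f w \<in> carrier G"
  using letter_val_closed by (induction w) force+

lemma word_val_append:
  assumes "f \<in> I \<rightarrow> carrier G" "u \<in> words I" "v \<in> words I"
  shows "word_val G f (u @ v) = word_val G f u \<otimes> word_val G f v"
  using assms(2)
proof (induction u)
  case Nil
  then show ?case using word_val_closed[OF assms(1,3)] by simp
next
  case (Cons x u)
  then have "x \<in> I \<times> UNIV" "u \<in> words I" by auto
  then show ?case
    using Cons.IH letter_val_closed[OF assms(1)] word_val_closed[OF assms(1)] assms(3)
    by (simp add: m_assoc)
qed

lemma word_val_free_cong: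
  assumes f: "f \<in> I \<rightarrow> carrier G" and "(u, v) \<in> free_cong I"
  shows "word_val G f u = word_val G f v"
  using assms(2)
proof (induction rule: free_cong.induct)
  case (cancel u v i b)
  have x: "(i, b) \<in> I \<times> UNIV" using cancel by simp
  have v: "word_val G f v \<in> carrier G" using word_val_closed[OF f] cancel by simp
  have "word_val G f ([(i, b), (i, \<not> b)] @ v) = word_val G f v"
    using letter_val_flip[OF f x] letter_val_closed[OF f x] v by (simp add: m_assoc[symmetric])
  then show ?case
    using word_val_append[OF f] cancel by simp
qed simp_all

text \<open>The constructors of \<open>generate\<close> match the empty word, the two kinds of
  letters and concatenation.\<close>

lemma word_val_generate:
  assumes f: "f \<in> I \<rightarrow> carrier G"
  shows "generate G (f ` I) = word_val G f ` words I"
proof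
  show "generate G (f ` I) \<subseteq> word_val G f ` words I"
  proof
    fix g assume "g \<in> generate G (f ` I)"
    then show "g \<in> word_val G f ` words I"
    proof (induction rule: generate.induct)
      case one
      show ?case by (rule image_eqI[of _ _ "[]"]) auto
    next
      case (incl h)
      then obtain i where "i \<in> I" "h = f i" by auto
      then show ?case using f by (intro image_eqI[of _ _ "[(i, True)]"]) (auto simp: letter_val_def Pi_iff)
    next
      case (inv h)
      then obtain i where "i \<in> I" "h = f i" by auto
      then show ?case using f by (intro image_eqI[of _ _ "[(i, False)]"]) (auto simp: letter_val_def Pi_iff)
    next
      case (eng h1 h2)
      then obtain u v where "u \<in> words I" "h1 = word_val G f u" "v \<in> words I" "h2 = word_val G f v"
        by auto
      then show ?case
        using word_val_append[OF f] by (intro image_eqI[of _ _ "u @ v"]) auto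
    qed
  qed
  show "word_val G f ` words I \<subseteq> generate G (f ` I)"
  proof (rule image_subsetI)
    fix w assume "w \<in> words I"
    then show "word_val G f w \<in> generate G (f ` I)"
    proof (induction w)
      case (Cons x w)
      then have "letter_val G f x \<in> generate G (f ` I)"
        by (auto simp: letter_val_def intro: generate.incl generate.inv)
      then show ?case
        using Cons by (simp add: generate.eng)
    qed (simp add: generate.one)
  qed
qed

text \<open>Every class contains its normal form, so testing reduced words is enough: a class in the
  kernel has a reduced representative of trivial value, which must be empty. The index set is
  arbitrary in order to serve both \<open>freely_generates\<close> and
  \<open>free_of_rank\<close>.\<close>

lemma free_group_iso_generate:
  assumes f: "f \<in> I \<rightarrow> carrier G"
    and nontrivial: "\<And>w. w \<in> words I \<Longrightarrow> reduced w \<Longrightarrow> w \<noteq> [] \<Longrightarrow> word_val G f w \<noteq> \<one>"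
  shows "\<exists>h \<in> iso (free_group I) (G\<lparr>carrier := generate G (f ` I)\<rparr>).
    \<forall>i\<in>I. h (free_gen I i) = f i"
proof -
  \<comment> \<open>Word values are constant on a congruence class, so the image is a
    singleton.\<close>
  define h where "h C = the_elem (word_val G f ` C)" for C
  have h: "h (free_cong I `` {u}) = word_val G f u" if u: "u \<in> words I" for u
  proof -
    have "word_val G f v = word_val G f u" if "v \<in> free_cong I `` {u}" for v
      using word_val_free_cong[OF f, of u v] that by simp
    moreover have "u \<in> free_cong I `` {u}"
      using free_cong.refl[OF u] by simp
    ultimately have "word_val G f ` (free_cong I `` {u}) = {word_val G f u}"
      by blast
    then show ?thesis by (simp add: h_def)
  qed
  have hom: "h \<in> hom (free_group I) (G\<lparr>carrier := generate G (f ` I)\<rparr>)"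
  proof (rule homI)
    fix x assume "x \<in> carrier (free_group I)"
    then obtain u where u: "u \<in> words I" "x = free_cong I `` {u}" by (rule free_group_carrierE)
    then show "h x \<in> carrier (G\<lparr>carrier := generate G (f ` I)\<rparr>)"
      using h word_val_generate[OF f] by simp
    fix y assume "y \<in> carrier (free_group I)"
    then obtain v where v: "v \<in> words I" "y = free_cong I `` {v}" by (rule free_group_carrierE)
    show "h (x \<otimes>\<^bsub>free_group I\<^esub> y) = h x \<otimes>\<^bsub>G\<lparr>carrier := generate G (f ` I)\<rparr>\<^esub> h y"
      using u v h word_val_append[OF f] free_group_mult[OF u(1) v(1)] by simp
  qed
  have grp: "group (G\<lparr>carrier := generate G (f ` I)\<rparr>)"
    using f by (intro subgroup_imp_group generate_is_subgroup) auto
  have "inj_on h (carrier (free_group I))"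
  proof (subst inj_on_one_iff'[OF hom group_free_group grp], intro allI impI)
    fix x assume "x \<in> carrier (free_group I)" and hx: "h x = \<one>\<^bsub>G\<lparr>carrier := generate G (f ` I)\<rparr>\<^esub>"
    then obtain u where u: "u \<in> words I" "x = free_cong I `` {u}"
      by (blast elim: free_group_carrierE)
    note cong = free_cong_norm_word[OF u(1)]
    have "word_val G f (norm_word u) = \<one>"
      using hx h u word_val_free_cong[OF f cong] by simp
    then have "norm_word u = []"
      using nontrivial reduced_norm_word free_cong_words(2)[OF cong] by blast
    then have "free_cong I `` {u} = free_cong I `` {[]}"
      using equiv_class_eq[OF equiv_free_cong cong] by simp
    then show "x = \<one>\<^bsub>free_group I\<^esub>"
      using u by (simp add: free_group_def)
  qed
  moreover have "h ` carrier (free_group I) = generate G (f ` I)"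
  proof -
    have "carrier (free_group I) = (\<lambda>u. free_cong I `` {u}) ` words I"
      by (auto elim: free_group_carrierE intro: free_group_carrierI)
    then show ?thesis
      using h word_val_generate[OF f] by (simp add: image_image cong: image_cong)
  qed
  ultimately have "h \<in> iso (free_group I) (G\<lparr>carrier := generate G (f ` I)\<rparr>)"
    using hom by (simp add: iso_def bij_betw_def)
  moreover have "h (free_gen I i) = f i" if "i \<in> I" for i
    using h[of "[(i, True)]"] that f by (auto simp: free_gen_def letter_val_def Pi_iff)
  ultimately show ?thesis by blast
qed

text \<open>Being free of a given rank is an abstract isomorphism. Transporting it to words gives an
  evaluation in which equality of group elements can be read off normal forms.\<close>

lemma free_of_rank_evaluation:
  assumes "free_of_rank (G\<lparr>carrier := F\<rparr>) k"
  obtains e where "e ` words {..<k} = F"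
    and "\<And>u v. u \<in> words {..<k} \<Longrightarrow> v \<in> words {..<k} \<Longrightarrow> e (u @ v) = e u \<otimes> e v"
    and "\<And>u v. u \<in> words {..<k} \<Longrightarrow> v \<in> words {..<k} \<Longrightarrow> 
      e u = e v \<longleftrightarrow> norm_word u = norm_word v"
proof -
  let ?I = "{..<k}"
  obtain h where h: "h \<in> iso (free_group ?I) (G\<lparr>carrier := F\<rparr>)"
    using assms by (auto simp: free_of_rank_def is_iso_def)
  have carr: "carrier (free_group ?I) = (\<lambda>u. free_cong ?I `` {u}) ` words ?I"
    by (auto elim: free_group_carrierE intro: free_group_carrierI)
  show thesis
  proof (rule that[of "\<lambda>u. h (free_cong ?I `` {u})"])
    show "(\<lambda>u. h (free_cong ?I `` {u})) ` words ?I = F"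
      using h by (simp add: iso_def bij_betw_def carr image_image)
    fix u v assume uv: "u \<in> words ?I" "v \<in> words ?I"
    then show "h (free_cong ?I `` {u @ v}) = h (free_cong ?I `` {u}) \<otimes> h (free_cong ?I `` {v})"
      using h free_group_mult[OF uv] hom_mult[of h "free_group ?I" "G\<lparr>carrier := F\<rparr>", OF _ uv[THEN free_group_carrierI]]
      by (simp add: iso_def)
    have "h (free_cong ?I `` {u}) = h (free_cong ?I `` {v}) \<longleftrightarrow>
        free_cong ?I `` {u} = free_cong ?I `` {v}"
      using h uv by (intro inj_on_eq_iff) (auto simp: iso_def bij_betw_def intro: free_group_carrierI)
    also have "\<dots> \<longleftrightarrow> (u, v) \<in> free_cong ?I"
      by (rule eq_equiv_class_iff[OF equiv_free_cong uv])
    also have "\<dots> \<longleftrightarrow> norm_word u = norm_word v"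
      using uv free_cong_norm_word free_cong.sym free_cong.trans norm_word_free_cong by metis
    finally show "h (free_cong ?I `` {u}) = h (free_cong ?I `` {v}) \<longleftrightarrow>
        norm_word u = norm_word v" .
  qed
qed

end


section \<open>Actions by homeomorphisms\<close>

locale homeomorphism_action = group G + group_action G "topspace X" \<phi>
  for G :: "('g, 'm) monoid_scheme" (structure) and X :: "'x topology" and \<phi> +
  assumes homeomorphic: "g \<in> carrier G \<Longrightarrow> homeomorphic_map X X (\<phi> g)"
begin

lemma act_one: "S \<subseteq> topspace X \<Longrightarrow> \<phi> \<one> ` S = S"
  using fun_cong[OF id_eq_one, symmetric] by (force simp: subset_iff)

lemma act_mult:
  "S \<subseteq> topspace X \<Longrightarrow> g \<in> carrier G \<Longrightarrow> h \<in> carrier G \<Longrightarrow> \<phi> (g \<otimes> h) ` S = \<phi> g ` \<phi> h ` S"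
  unfolding image_image by (rule image_cong) (auto simp: composition_rule)

lemma act_mult_subset:
  "\<phi> h ` S \<subseteq> R \<Longrightarrow> \<phi> g ` R \<subseteq> T \<Longrightarrow> S \<subseteq> topspace X \<Longrightarrow> g \<in> carrier G \<Longrightarrow> h \<in> carrier G \<Longrightarrow>
    \<phi> (g \<otimes> h) ` S \<subseteq> T"
  by (metis act_mult image_mono order_trans)

lemma act_subset_topspace: "g \<in> carrier G \<Longrightarrow> S \<subseteq> topspace X \<Longrightarrow> \<phi> g ` S \<subseteq> topspace X"
  using surj_prop by blast

lemma act_inv: "g \<in> carrier G \<Longrightarrow> S \<subseteq> topspace X \<Longrightarrow> \<phi> (inv g) ` \<phi> g ` S = S"
  using act_mult[of S "inv g" g] act_one by simp

lemma act_open: "g \<in> carrier G \<Longrightarrow> openin X U \<Longrightarrow> openin X (\<phi> g ` U)"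
  using homeomorphic_imp_open_map[OF homeomorphic] by (simp add: open_map_def)

lemma act_Int:
  "g \<in> carrier G \<Longrightarrow> S \<subseteq> topspace X \<Longrightarrow> T \<subseteq> topspace X \<Longrightarrow> \<phi> g ` (S \<inter> T) = \<phi> g ` S \<inter> \<phi> g ` T"
  using inj_prop by (rule inj_on_image_Int)

lemma act_Diff:
  "g \<in> carrier G \<Longrightarrow> S \<subseteq> topspace X \<Longrightarrow> T \<subseteq> S \<Longrightarrow> \<phi> g ` (S - T) = \<phi> g ` S - \<phi> g ` T"
  using inj_prop by (rule inj_on_image_set_diff) auto

lemma act_inv_invariant:
  "g \<in> carrier G \<Longrightarrow> Y \<subseteq> topspace X \<Longrightarrow> \<phi> g ` Y = Y \<Longrightarrow> \<phi> (inv g) ` Y = Y"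
  using act_inv[of g Y] by simp

text \<open>An injective map that preserves \<open>Y\<close> carries complements in \<open>Y\<close>
  to complements in \<open>Y\<close>.\<close>

lemma act_inv_complement:
  assumes "g \<in> carrier G" "Y \<subseteq> topspace X" "\<phi> g ` Y = Y" "B \<subseteq> Y"
  shows "\<phi> (inv g) ` (Y - \<phi> g ` B) = Y - B"
proof -
  have "\<phi> g ` (Y - B) = Y - \<phi> g ` B"
    using act_Diff[OF assms(1,2,4)] assms(3) by simp
  then show ?thesis
    using act_inv[of g "Y - B"] assms(1,2) by (metis Diff_subset order_trans)
qed


section \<open>Properly discontinuous orbits\<close>

lemma translates_subgroup_invariant:
  assumes F: "subgroup F G" and U: "U \<subseteq> topspace X" and f: "f \<in> F"
  shows "\<phi> f ` translates \<phi> F U = translates \<phi> F U"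
proof -
  note [simp] = subgroup.mem_carrier[OF F] subgroup.m_closed[OF F] subgroup.m_inv_closed[OF F]
  have sub: "\<phi> g ` translates \<phi> F U \<subseteq> translates \<phi> F U" if "g \<in> F" for g
  proof -
    have "\<phi> g ` \<phi> h ` U \<subseteq> translates \<phi> F U" if "h \<in> F" for h
      using act_mult[OF U, of g h] \<open>g \<in> F\<close> that UN_upper[of "g \<otimes> h" F "\<lambda>h. \<phi> h ` U"]
      by (simp add: translates_def)
    then have "\<phi> g ` (\<Union>h\<in>F. \<phi> h ` U) \<subseteq> translates \<phi> F U"
      unfolding image_UN by blast
    then show ?thesis by (simp add: translates_def)
  qed
  have Z: "translates \<phi> F U \<subseteq> topspace X"
    using act_subset_topspace[OF _ U] subgroup.subset[OF F] by (auto simp: translates_def)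
  \<comment> \<open>The inclusion for \<open>inv f\<close>, pushed forward by \<open>f\<close>, is
    the reverse inclusion for \<open>f\<close>.\<close>
  have "translates \<phi> F U = \<phi> f ` \<phi> (inv f) ` translates \<phi> F U"
    using act_inv[of "inv f", OF _ Z] f by simp
  also have "\<dots> \<subseteq> \<phi> f ` translates \<phi> F U"
    using sub[of "inv f"] f by (intro image_mono) simp
  finally show ?thesis
    using sub[OF f] by (intro subset_antisym)
qed

lemma translates_translates_subgroup:
  assumes "subgroup F G" "U \<subseteq> topspace X"
  shows "translates \<phi> F (translates \<phi> F U) = translates \<phi> F U"
proof -
  have "translates \<phi> F (translates \<phi> F U) = (\<Union>f\<in>F. translates \<phi> F U)"
    unfolding translates_def[of _ _ "translates \<phi> F U"]
    by (intro SUP_cong HOL.refl translates_subgroup_invariant[OF assms])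
  then show ?thesis
    using subgroup.one_closed[OF assms(1)] by auto
qed

lemma openin_translates: "H \<subseteq> carrier G \<Longrightarrow> openin X U \<Longrightarrow> openin X (translates \<phi> H U)"
  unfolding translates_def using act_open by (intro openin_Union) auto

lemma acts_by_homeomorphisms_invariant:
  assumes F: "subgroup F G" and Z: "Z \<subseteq> topspace X" and inv: "\<And>f. f \<in> F \<Longrightarrow> \<phi> f ` Z = Z"
  shows "acts_by_homeomorphisms (G\<lparr>carrier := F\<rparr>) (subtopology X Z) (\<lambda>f. restrict (\<phi> f) Z)"
proof -
  note [simp] = subgroup.mem_carrier[OF F] subgroup.m_closed[OF F] subgroup.m_inv_closed[OF F]
  have top: "topspace (subtopology X Z) = Z"
    using Z by auto
  have Bij: "restrict (\<phi> f) Z \<in> Bij Z" if "f \<in> F" for f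
    using inv[OF that] inj_prop[of f] Z that
    by (auto simp: Bij_def bij_betw_def inj_on_restrict_eq intro: inj_on_subset)
  have hom: "(\<lambda>f. restrict (\<phi> f) Z) \<in> hom (G\<lparr>carrier := F\<rparr>) (BijGroup Z)"
  proof (rule homI)
    fix f g assume fg: "f \<in> carrier (G\<lparr>carrier := F\<rparr>)" "g \<in> carrier (G\<lparr>carrier := F\<rparr>)"
    \<comment> \<open>Outside \<open>Z\<close> both sides are \<open>undefined\<close>; inside,
      invariance keeps the image of \<open>z\<close> under \<open>g\<close> in \<open>Z\<close>,
      where the outer restriction has no effect.\<close>
    have "restrict (\<phi> (f \<otimes> g)) Z = compose Z (restrict (\<phi> f) Z) (restrict (\<phi> g) Z)"
    proof (rule ext)
      fix z show "restrict (\<phi> (f \<otimes> g)) Z z = compose Z (restrict (\<phi> f) Z) (restrict (\<phi> g) Z) z"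
        using fg inv[of g] Z composition_rule[of z f g] by (auto simp: compose_def)
    qed
    then show "restrict (\<phi> (f \<otimes>\<^bsub>G\<lparr>carrier := F\<rparr>\<^esub> g)) Z =
        restrict (\<phi> f) Z \<otimes>\<^bsub>BijGroup Z\<^esub> restrict (\<phi> g) Z"
      using fg Bij by (simp add: BijGroup_def)
  qed (simp add: BijGroup_def Bij)
  have "homeomorphic_map (subtopology X Z) (subtopology X Z) (restrict (\<phi> f) Z)" if "f \<in> F" for f
  proof (rule homeomorphic_map_eq)
    show "homeomorphic_map (subtopology X Z) (subtopology X Z) (\<phi> f)"
      using homeomorphic[of f] inv[OF that] Z that
      by (intro homeomorphic_map_subtopologies) (auto simp: Int_absorb1)
  qed (use top in simp)
  then show ?thesis
    using hom subgroup_imp_group[OF F] group_BijGroup[of Z] unfolding acts_by_homeomorphisms_def top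
    by (auto intro!: group_action.intro group_hom.intro group_hom_axioms.intro)
qed

text \<open>The translate of \<open>U\<close> by \<open>f\<close> is a neighborhood of each of its
  points. An element \<open>h\<close> overlaps it with itself only if the conjugate
  \<open>inv f \<otimes> (h \<otimes> f)\<close>, which is nontrivial along with \<open>h\<close>,
  overlaps \<open>U\<close> with itself.\<close>

lemma properly_discontinuous_translates:
  assumes F: "subgroup F G" and U: "openin X U"
    and free: "\<And>h. h \<in> F \<Longrightarrow> h \<noteq> \<one> \<Longrightarrow> \<phi> h ` U \<inter> U = {}"
  shows "properly_discontinuous_on G X \<phi> F (translates \<phi> F U)"
proof -
  note [simp] = subgroup.mem_carrier[OF F] subgroup.m_closed[OF F] subgroup.m_inv_closed[OF F]
  let ?Z = "translates \<phi> F U"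
  have UX: "U \<subseteq> topspace X" using U by (rule openin_subset)
  note inv = translates_subgroup_invariant[OF F UX]
  have Z: "openin X ?Z" using subgroup.subset[OF F] U by (rule openin_translates)
  then have ZX: "?Z \<subseteq> topspace X" by (rule openin_subset)
  have "\<exists>V. openin (subtopology X ?Z) V \<and> z \<in> V \<and>
      (\<forall>h\<in>F. h \<noteq> \<one> \<longrightarrow> restrict (\<phi> h) ?Z ` V \<inter> V = {})" if z: "z \<in> ?Z" for z
  proof -
    obtain f where f: "f \<in> F" "z \<in> \<phi> f ` U"
      using z by (auto simp: translates_def)
    have VZ: "\<phi> f ` U \<subseteq> ?Z" using f(1) by (auto simp: translates_def)
    have "restrict (\<phi> h) ?Z ` \<phi> f ` U \<inter> \<phi> f ` U = {}" if h: "h \<in> F" "h \<noteq> \<one>" for h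
    proof -
      let ?k = "inv f \<otimes> (h \<otimes> f)"
      have conj: "f \<otimes> ?k = h \<otimes> f"
        using f(1) h(1) by (simp add: m_assoc[symmetric])
      have "?k \<noteq> \<one>"
      proof
        assume "?k = \<one>"
        then have "h \<otimes> f = f" using conj f(1) by simp
        then show False using f(1) h by simp
      qed
      then have "\<phi> ?k ` U \<inter> U = {}" using free f(1) h(1) by simp
      moreover have "\<phi> f ` \<phi> ?k ` U = \<phi> h ` \<phi> f ` U"
        using act_mult[OF UX, of f ?k] act_mult[OF UX, of h f] conj f(1) h(1) by simp
      ultimately have "\<phi> h ` \<phi> f ` U \<inter> \<phi> f ` U = {}"
        using act_Int[of f "\<phi> ?k ` U" U] act_subset_topspace[OF _ UX, of ?k] UX f(1) h(1) by simp
      moreover have "restrict (\<phi> h) ?Z ` \<phi> f ` U = \<phi> h ` \<phi> f ` U"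
        using VZ by (intro image_cong) auto
      ultimately show ?thesis by simp
    qed
    moreover have "openin (subtopology X ?Z) (\<phi> f ` U)"
      using VZ Z act_open[OF _ U, of f] f(1) by (simp add: openin_open_subtopology)
    ultimately show ?thesis using f(2) by blast
  qed
  then show ?thesis
    using acts_by_homeomorphisms_invariant[OF F ZX inv] ZX
    unfolding properly_discontinuous_on_def properly_discontinuous_action_def
    by (simp add: Int_absorb1)
qed


section \<open>Schottky families\<close>

text \<open>
  The set \<open>U (i, True)\<close> attracts \<open>f i\<close>, and \<open>U (i, False)\<close> attracts its inverse.
\<close>

definition schottky :: "'i set \<Rightarrow> ('i \<Rightarrow> 'g) \<Rightarrow> ('i \<times> bool \<Rightarrow> 'x set) \<Rightarrow> bool"
  where "schottky I f U \<longleftrightarrow> f \<in> I \<rightarrow> carrier G \<and>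
    (\<forall>x\<in>I \<times> UNIV. U x \<subseteq> topspace X \<and> U x \<noteq> {}) \<and> disjoint_family_on U (I \<times> UNIV) \<and>
    (\<forall>x\<in>I \<times> UNIV. \<forall>y\<in>I \<times> UNIV. y \<noteq> flip x \<longrightarrow> \<phi> (letter_val G f x) ` U y \<subseteq> U x)"

lemma schottkyD:
  assumes "schottky I f U"
  shows "f \<in> I \<rightarrow> carrier G"
    and "x \<in> I \<times> UNIV \<Longrightarrow> U x \<subseteq> topspace X"
    and "x \<in> I \<times> UNIV \<Longrightarrow> U x \<noteq> {}"
    and "x \<in> I \<times> UNIV \<Longrightarrow> y \<in> I \<times> UNIV \<Longrightarrow> x \<noteq> y \<Longrightarrow> U x \<inter> U y = {}"
    and "x \<in> I \<times> UNIV \<Longrightarrow> y \<in> I \<times> UNIV \<Longrightarrow> y \<noteq> flip x \<Longrightarrow>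
      \<phi> (letter_val G f x) ` U y \<subseteq> U x"
proof -
  note U = assms[unfolded schottky_def disjoint_family_on_def]
  show "f \<in> I \<rightarrow> carrier G"
    by (rule U[THEN conjunct1])
  show "U x \<subseteq> topspace X" if "x \<in> I \<times> UNIV"
    by (rule U[THEN conjunct2, THEN conjunct1, THEN bspec, OF that, THEN conjunct1])
  show "U x \<noteq> {}" if "x \<in> I \<times> UNIV"
    by (rule U[THEN conjunct2, THEN conjunct1, THEN bspec, OF that, THEN conjunct2])
  show "U x \<inter> U y = {}" if "x \<in> I \<times> UNIV" "y \<in> I \<times> UNIV" "x \<noteq> y"
    by (rule U[THEN conjunct2, THEN conjunct2, THEN conjunct1, THEN bspec, THEN bspec, THEN mp, OF that])
  show "\<phi> (letter_val G f x) ` U y \<subseteq> U x" if "x \<in> I \<times> UNIV" "y \<in> I \<times> UNIV" "y \<noteq> flip x"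
    by (rule U[THEN conjunct2, THEN conjunct2, THEN conjunct2, THEN bspec, THEN bspec, THEN mp, OF that])
qed

text \<open>This serves to index a family by its own generators, as \<open>freely_generates\<close>
  requires.\<close>

lemma schottky_reindex:
  assumes "schottky I f U" "inj_on r J" "r ` J \<subseteq> I" "\<And>j. j \<in> J \<Longrightarrow> f' j = f (r j)"
  shows "schottky J f' (U \<circ> apfst r)"
proof -
  have r: "apfst r x \<in> I \<times> UNIV" "letter_val G f' x = letter_val G f (apfst r x)"
    if "x \<in> J \<times> UNIV" for x
    using that assms(3,4) by (auto simp: letter_val_def)
  have inj: "apfst r x = apfst r y \<longleftrightarrow> x = y" if "x \<in> J \<times> UNIV" "y \<in> J \<times> UNIV" for x y
    using that assms(2) by (cases x; cases y) (auto simp: inj_on_eq_iff)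
  have flip: "apfst r y \<noteq> flip (apfst r x)" if "x \<in> J \<times> UNIV" "y \<in> J \<times> UNIV" "y \<noteq> flip x" for x y
    using inj[of y "flip x"] that by (cases x) auto
  have "f' \<in> J \<rightarrow> carrier G"
    using schottkyD(1)[OF assms(1)] assms(3,4) by (auto simp: Pi_iff image_subset_iff)
  moreover have "U (apfst r x) \<inter> U (apfst r y) = {}"
    if "x \<in> J \<times> UNIV" "y \<in> J \<times> UNIV" "x \<noteq> y" for x y
    using schottkyD(4)[OF assms(1) r(1)[OF that(1)] r(1)[OF that(2)]] inj[OF that(1,2)] that(3) by metis
  moreover have "\<phi> (letter_val G f' x) ` U (apfst r y) \<subseteq> U (apfst r x)"
    if "x \<in> J \<times> UNIV" "y \<in> J \<times> UNIV" "y \<noteq> flip x" for x y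
    using schottkyD(5)[OF assms(1) r(1)[OF that(1)] r(1)[OF that(2)] flip[OF that]] r(2)[OF that(1)]
    by simp
  moreover have "U (apfst r x) \<subseteq> topspace X \<and> U (apfst r x) \<noteq> {}" if "x \<in> J \<times> UNIV" for x
    using schottkyD(2,3)[OF assms(1) r(1)[OF that]] by (rule conjI)
  ultimately show ?thesis
    unfolding schottky_def disjoint_family_on_def comp_apply by (metis (no_types))
qed

text \<open>The word acts from right to left: its last letter brings \<open>S\<close> into its own
  set, and by reducedness no earlier letter is the inverse of the one whose set it receives.
  \<open>S\<close> is kept general, to be either a ping-pong set or a base set.\<close>

lemma word_val_image_subset:
  assumes U: "schottky I f U"
    and w: "w \<in> words I" "reduced w" "w \<noteq> []"
    and S: "S \<subseteq> topspace X" "\<phi> (letter_val G f (last w)) ` S \<subseteq> U (last w)"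
  shows "\<phi> (word_val G f w) ` S \<subseteq> U (hd w)"
  using w S(2)
proof (induction w rule: list.induct)
  case (Cons x w)
  note f = schottkyD(1)[OF U]
  have x: "x \<in> I \<times> UNIV" and w: "w \<in> words I" using Cons.prems(1) by auto
  note closed = letter_val_closed[OF f x] word_val_closed[OF f w]
  show ?case
  proof (cases "w = []")
    case True
    then show ?thesis using Cons.prems closed by simp
  next
    case False
    then have "\<phi> (word_val G f w) ` S \<subseteq> U (hd w)"
      using Cons by (auto simp: successively_Cons)
    moreover have "hd w \<in> I \<times> UNIV"
      using False w by (cases w) auto
    then have "\<phi> (letter_val G f x) ` U (hd w) \<subseteq> U x"
      using schottkyD(5)[OF U x, of "hd w"] Cons.prems False by (simp add: successively_Cons)
    ultimately show ?thesis
      using act_mult_subset S(1) closed by simp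
  qed
qed simp

lemma schottky_word_val_nontrivial:
  assumes U: "schottky I f U" and ij: "i \<in> I" "j \<in> I" "i \<noteq> j"
    and w: "w \<in> words I" "reduced w" "w \<noteq> []"
  shows "word_val G f w \<noteq> \<one>"
proof
  assume one: "word_val G f w = \<one>"
  have hd: "hd w \<in> I \<times> UNIV" and last: "last w \<in> I \<times> UNIV"
    using w(1,3) by (metis in_lists_conv_set hd_in_set, metis in_lists_conv_set last_in_set)
  \<comment> \<open>Only two letters are forbidden, so one of three distinct letters is available;
    the second index provides the third.\<close>
  obtain y where y: "y \<in> I \<times> UNIV" "y \<noteq> flip (last w)" "y \<noteq> hd w"
  proof -
    have "\<exists>y\<in>{(i, True), (i, False), (j, True)}. y \<noteq> flip (last w) \<and> y \<noteq> hd w"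
      using ij(3) by (cases "hd w"; cases "last w") auto
    then show thesis using that ij by blast
  qed
  then have "U y \<subseteq> topspace X" "\<phi> (letter_val G f (last w)) ` U y \<subseteq> U (last w)"
    using schottkyD(2,5)[OF U] last by simp_all
  then have "U y \<subseteq> U (hd w)"
    using word_val_image_subset[OF U w] one act_one by simp
  moreover have "U y \<inter> U (hd w) = {}" "U y \<noteq> {}"
    using schottkyD(3,4)[OF U] y hd by simp_all
  ultimately show False by blast
qed

section \<open>Freeness of the groups generated by Schottky families\<close>

lemma schottky_iso:
  assumes U: "schottky I f U" and "i \<in> I" "j \<in> I" "i \<noteq> j"
  shows "\<exists>h \<in> iso (free_group I) (G\<lparr>carrier := generate G (f ` I)\<rparr>).
    \<forall>i\<in>I. h (free_gen I i) = f i"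
  by (rule free_group_iso_generate[OF schottkyD(1)[OF U]]) (rule schottky_word_val_nontrivial[OF assms])

text \<open>Equal generators at distinct indices would give a reduced word of length two with
  trivial value.\<close>

lemma schottky_inj_on:
  assumes "schottky I f U"
  shows "inj_on f I"
proof (rule inj_onI, rule ccontr)
  fix i j assume ij: "i \<in> I" "j \<in> I" "f i = f j" "i \<noteq> j"
  have "f j \<in> carrier G" using schottkyD(1)[OF assms] ij(2) by blast
  then have "word_val G f [(i, True), (j, False)] = \<one>"
    using ij by (simp add: letter_val_def)
  moreover have "[(i, True), (j, False)] \<in> words I" "reduced [(i, True), (j, False)]"
    using ij(1,2,4) by simp_all
  ultimately show False
    using schottky_word_val_nontrivial[OF assms ij(1,2,4)] by blast
qed

lemma schottky_freely_generates:
  assumes U: "schottky I f U" and ij: "i \<in> I" "j \<in> I" "i \<noteq> j"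
  shows "freely_generates G (f ` I)"
proof -
  note inj = schottky_inj_on[OF U]
  have "schottky (f ` I) (\<lambda>g. g) (U \<circ> apfst (inv_into I f))"
    by (rule schottky_reindex[OF U])
      (simp_all add: inj_on_inv_into inv_into_into image_subset_iff f_inv_into_f)
  moreover have "f i \<in> f ` I" "f j \<in> f ` I" "f i \<noteq> f j"
    using ij inj by (auto simp: inj_on_eq_iff)
  ultimately have "\<exists>h\<in>iso (free_group (f ` I)) (G\<lparr>carrier := generate G ((\<lambda>g. g) ` f ` I)\<rparr>).
      \<forall>s\<in>f ` I. h (free_gen (f ` I) s) = s"
    by (rule schottky_iso)
  moreover have "f ` I \<subseteq> carrier G"
    using schottkyD(1)[OF U] by blast
  ultimately show ?thesis
    by (simp only: freely_generates_def image_ident)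
qed

lemma schottky_free_of_rank:
  assumes "schottky {..<k} f U" "k \<ge> 2"
  shows "free_of_rank (G\<lparr>carrier := generate G (f ` {..<k})\<rparr>) k"
proof -
  have "\<exists>h \<in> iso (free_group {..<k}) (G\<lparr>carrier := generate G (f ` {..<k})\<rparr>).
      \<forall>i\<in>{..<k}. h (free_gen {..<k} i) = f i"
    using assms(2) by (intro schottky_iso[OF assms(1), of 0 1]) auto
  then show ?thesis
    unfolding free_of_rank_def is_iso_def by blast
qed

text \<open>Every letter sends \<open>B\<close> into its own set, so \<open>B\<close> can start the
  ping-pong for any last letter. The normal form of a nontrivial \<open>h\<close> is nonempty and
  takes \<open>B\<close> into the set of its first letter, which misses \<open>B\<close>.\<close>

lemma schottky_base_disjoint:
  assumes U: "schottky I f U"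
    and B: "B \<subseteq> topspace X" "\<And>x. x \<in> I \<times> UNIV \<Longrightarrow> B \<inter> U x = {}"
      "\<And>x. x \<in> I \<times> UNIV \<Longrightarrow> \<phi> (letter_val G f x) ` B \<subseteq> U x"
    and h: "h \<in> generate G (f ` I)" "h \<noteq> \<one>"
  shows "\<phi> h ` B \<inter> B = {}"
proof -
  note f = schottkyD(1)[OF U]
  obtain u where u: "u \<in> words I" "h = word_val G f u"
    using h(1) word_val_generate[OF f] by auto
  define w where "w = norm_word u"
  have w: "w \<in> words I" "reduced w" "h = word_val G f w"
    using free_cong_words(2)[OF free_cong_norm_word[OF u(1)]] u(2) reduced_norm_word
      word_val_free_cong[OF f free_cong_norm_word[OF u(1)]] unfolding w_def by simp_all
  with h(2) have "w \<noteq> []" by auto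
  then have "hd w \<in> I \<times> UNIV" "last w \<in> I \<times> UNIV"
    using w(1) by (metis in_lists_conv_set hd_in_set, metis in_lists_conv_set last_in_set)
  then have "\<phi> h ` B \<subseteq> U (hd w)" "B \<inter> U (hd w) = {}"
    using word_val_image_subset[OF U w(1,2) \<open>w \<noteq> []\<close> B(1)] B(2,3) w(3) by simp_all
  then show ?thesis by blast
qed

lemma schottky_properly_discontinuous:
  assumes U: "schottky {..<k} f U" and k: "k \<ge> 2"
    and B: "openin X B" "\<And>x. x \<in> {..<k} \<times> UNIV \<Longrightarrow> B \<inter> U x = {}"
      "\<And>x. x \<in> {..<k} \<times> UNIV \<Longrightarrow> \<phi> (letter_val G f x) ` B \<subseteq> U x"
    and F: "F = generate G (f ` {..<k})" and Z: "Z = translates \<phi> F B"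
  shows "subgroup F G" "free_of_rank (G\<lparr>carrier := F\<rparr>) k"
    "openin X Z" "translates \<phi> F Z = Z" "properly_discontinuous_on G X \<phi> F Z"
proof -
  have BX: "B \<subseteq> topspace X" using B(1) by (rule openin_subset)
  show sub: "subgroup F G"
    unfolding F using schottkyD(1)[OF U] by (intro generate_is_subgroup) auto
  show "free_of_rank (G\<lparr>carrier := F\<rparr>) k"
    unfolding F using U k by (rule schottky_free_of_rank)
  show "openin X Z"
    unfolding Z using subgroup.subset[OF sub] B(1) by (rule openin_translates)
  show "translates \<phi> F Z = Z"
    unfolding Z using sub BX by (rule translates_translates_subgroup)
  show "properly_discontinuous_on G X \<phi> F Z"
    unfolding Z using sub B(1)
  proof (rule properly_discontinuous_translates)
    fix h assume "h \<in> F" "h \<noteq> \<one>"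
    then show "\<phi> h ` B \<inter> B = {}"
      using schottky_base_disjoint[OF U BX B(2,3)] F by blast
  qed
qed

text \<open>By disjointness, all ping-pong sets other than \<open>U (flip x)\<close> lie in its
  complement in \<open>Y\<close>, so each letter needs only one inclusion.\<close>

lemma schottkyI:
  assumes "f \<in> I \<rightarrow> carrier G" "Y \<subseteq> topspace X"
    and "\<And>x. x \<in> I \<times> UNIV \<Longrightarrow> U x \<subseteq> Y" "\<And>x. x \<in> I \<times> UNIV \<Longrightarrow> U x \<noteq> {}"
    and "\<And>x y. x \<in> I \<times> UNIV \<Longrightarrow> y \<in> I \<times> UNIV \<Longrightarrow> x \<noteq> y \<Longrightarrow> U x \<inter> U y = {}"
    and "\<And>x. x \<in> I \<times> UNIV \<Longrightarrow> \<phi> (letter_val G f x) ` (Y - U (flip x)) \<subseteq> U x"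
  shows "schottky I f U"
proof -
  have "\<phi> (letter_val G f x) ` U y \<subseteq> U x" if x: "x \<in> I \<times> UNIV" and y: "y \<in> I \<times> UNIV" "y \<noteq> flip x" for x y
  proof -
    have "flip x \<in> I \<times> UNIV" using x by (cases x) simp
    then have "U y \<subseteq> Y - U (flip x)"
      using assms(3)[OF y(1)] assms(5)[OF y(1) \<open>flip x \<in> I \<times> UNIV\<close> y(2)] by blast
    then show ?thesis
      using assms(6)[OF x] by (meson image_mono order_trans)
  qed
  moreover have "U x \<subseteq> topspace X \<and> U x \<noteq> {}" if "x \<in> I \<times> UNIV" for x
    using assms(2) assms(3,4)[OF that] by simp
  ultimately show ?thesis
    unfolding schottky_def disjoint_family_on_def using assms(1,5) by (metis (no_types))
qed


section \<open>Ping-pong from systems\<close>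

text \<open>What lies in \<open>Y\<close> outside the translate of \<open>A\<close> by
  \<open>a\<close> lies in \<open>A\<close>, which settles \<open>a\<close>. What lies outside
  \<open>A\<close> lies in that translate, and applying \<open>inv a\<close> settles the
  inverse.\<close>

lemma complement_image_subset:
  assumes "a \<in> carrier G" "Y \<subseteq> topspace X" "A \<subseteq> Y" "Y = A \<union> \<phi> a ` A" "\<phi> a ` Y = Y"
  shows "\<phi> a ` (Y - A) \<subseteq> A" "\<phi> (inv a) ` (Y - A) \<subseteq> A"
proof -
  show "\<phi> a ` (Y - A) \<subseteq> A"
    unfolding act_Diff[OF assms(1-3)] assms(5) using equalityD1[OF assms(4)] by blast
  have "Y - A \<subseteq> \<phi> a ` A"
    using equalityD1[OF assms(4)] by blast
  then have "\<phi> (inv a) ` (Y - A) \<subseteq> \<phi> (inv a) ` \<phi> a ` A"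
    by (rule image_mono)
  also have "\<dots> = A"
    using assms(1-3) by (intro act_inv) auto
  finally show "\<phi> (inv a) ` (Y - A) \<subseteq> A" .
qed

text \<open>First \<open>inv h\<close> takes the complement of the translate of \<open>A\<close> by
  \<open>h\<close> back to \<open>Y - A\<close>, then \<open>c\<close> takes this into
  \<open>A\<close>, and \<open>g\<close> moves \<open>A\<close> to its target. The cases
  \<open>c = a\<close> and \<open>c = inv a\<close> treat a generator and its inverse alike.\<close>

lemma conjugate_image_subset:
  assumes "c \<in> carrier G" "g \<in> carrier G" "h \<in> carrier G" "Y \<subseteq> topspace X" "A \<subseteq> Y"
    and "\<phi> c ` (Y - A) \<subseteq> A" "\<phi> h ` Y = Y"
  shows "\<phi> (g \<otimes> c \<otimes> inv h) ` (Y - \<phi> h ` A) \<subseteq> \<phi> g ` A"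
proof -
  have "\<phi> (inv h) ` (Y - \<phi> h ` A) \<subseteq> Y - A"
    using act_inv_complement assms by simp
  moreover have "\<phi> (g \<otimes> c) ` (Y - A) \<subseteq> \<phi> g ` A"
    by (rule act_mult_subset[OF assms(6)]) (use assms in auto)
  ultimately show ?thesis
    by (rule act_mult_subset) (use assms in auto)
qed

lemma n_systemD:
  assumes "n_system G X \<phi> n A Y a b"
  shows "n \<ge> 3" "openin X A" "A \<noteq> {}" "openin X Y" "A \<subseteq> Y" "Y \<subseteq> topspace X" "a \<in> carrier G"
    "Y = A \<union> \<phi> a ` A" "\<phi> a ` Y = Y"
    "i < n \<Longrightarrow> b i \<in> carrier G" "i < n \<Longrightarrow> \<phi> (b i) ` Y = Y"
    "i < n \<Longrightarrow> j < n \<Longrightarrow> i \<noteq> j \<Longrightarrow> \<phi> (b i) ` A \<inter> \<phi> (b j) ` A = {}"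
    "i < n \<Longrightarrow> openin X (\<phi> (b i) ` A)" "i < n \<Longrightarrow> \<phi> (b i) ` A \<subseteq> Y"
proof -
  note s = assms[unfolded n_system_def]
  show "n \<ge> 3" "openin X A" "A \<noteq> {}" "openin X Y" "A \<subseteq> Y" "a \<in> carrier G"
    "Y = A \<union> \<phi> a ` A" "\<phi> a ` Y = Y"
    using s by argo+
  show "Y \<subseteq> topspace X"
    using \<open>openin X Y\<close> by (rule openin_subset)
  show "i < n \<Longrightarrow> \<phi> (b i) ` A \<inter> \<phi> (b j) ` A = {}" if "j < n" "i \<noteq> j"
    using s that by (simp add: disjoint_family_on_def)
  assume i: "i < n"
  show b: "b i \<in> carrier G" "\<phi> (b i) ` Y = Y"
    using s[THEN conjunct2] i by metis+
  show "openin X (\<phi> (b i) ` A)"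
    using b(1) \<open>openin X A\<close> by (rule act_open)
  show "\<phi> (b i) ` A \<subseteq> Y"
    using image_mono[OF \<open>A \<subseteq> Y\<close>] b(2) by metis
qed

text \<open>Inverting a generator replaces \<open>a\<close> by \<open>inv a\<close> and exchanges
  the two outer elements, which is exactly the exchange of \<open>x\<close> and
  \<open>flip x\<close> under \<open>r\<close>.\<close>

lemma n_system_letter_val:
  assumes s: "n_system G X \<phi> n A Y a b"
    and r: "\<And>x. x \<in> I \<times> UNIV \<Longrightarrow> r x < n"
    and f: "\<And>i. i \<in> I \<Longrightarrow> f i = b (r (i, True)) \<otimes> a \<otimes> inv b (r (i, False))"
    and x: "x \<in> I \<times> UNIV"
  shows "\<phi> (letter_val G f x) ` (Y - \<phi> (b (r (flip x))) ` A) \<subseteq> \<phi> (b (r x)) ` A"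
proof -
  note sys = n_systemD[OF s]
  obtain i c where ic: "x = (i, c)" "i \<in> I" using x by auto
  have ri: "r (i, c) < n" for c using r ic(2) by simp
  note maps = complement_image_subset[OF sys(7,6,5,8,9)]
  have "inv (b (r (i, True)) \<otimes> a \<otimes> inv b (r (i, False))) =
      b (r (i, False)) \<otimes> inv a \<otimes> inv b (r (i, True))"
    using sys(7) sys(10)[OF ri] by (simp add: inv_mult_group m_assoc)
  then have "letter_val G f x = b (r x) \<otimes> (if c then a else inv a) \<otimes> inv b (r (flip x))"
    using f ic by (simp add: letter_val_def)
  moreover have "\<phi> (if c then a else inv a) ` (Y - A) \<subseteq> A"
    using maps by simp
  ultimately show ?thesis
    using conjugate_image_subset[of "if c then a else inv a" "b (r x)" "b (r (flip x))" Y A]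
      sys(5-7) sys(10)[OF ri] sys(11)[OF ri] ic(1) by simp
qed

text \<open>Injectivity of \<open>r\<close> gives distinct letters distinct translates of
  \<open>A\<close>, hence disjoint ping-pong sets.\<close>

lemma n_system_schottky:
  assumes s: "n_system G X \<phi> n A Y a b"
    and r: "\<And>x. x \<in> I \<times> UNIV \<Longrightarrow> r x < n" "inj_on r (I \<times> UNIV)"
    and f: "\<And>i. i \<in> I \<Longrightarrow> f i = b (r (i, True)) \<otimes> a \<otimes> inv b (r (i, False))"
  shows "schottky I f (\<lambda>x. \<phi> (b (r x)) ` A)"
proof (rule schottkyI)
  note sys = n_systemD[OF s]
  show "f \<in> I \<rightarrow> carrier G"
    using f sys(7,10) r(1) by simp
  show "Y \<subseteq> topspace X" by (rule sys(6))
  fix x assume x: "x \<in> I \<times> (UNIV :: bool set)"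
  show "\<phi> (b (r x)) ` A \<subseteq> Y" by (rule sys(14)[OF r(1)[OF x]])
  show "\<phi> (b (r x)) ` A \<noteq> {}" using sys(3) by simp
  show "\<phi> (letter_val G f x) ` (Y - \<phi> (b (r (flip x))) ` A) \<subseteq> \<phi> (b (r x)) ` A"
    using s r(1) f x by (rule n_system_letter_val)
  fix y assume y: "y \<in> I \<times> (UNIV :: bool set)" "x \<noteq> y"
  show "\<phi> (b (r x)) ` A \<inter> \<phi> (b (r y)) ` A = {}"
    using inj_onD[OF r(2) _ x y(1)] y(2) by (intro sys(12)[OF r(1)[OF x] r(1)[OF y(1)]]) blast
qed

text \<open>Three translates cannot supply four ping-pong sets directly. The conjugate of
  \<open>a\<close> by \<open>c i\<close> attracts to a set outside \<open>A\<close>, and the extra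
  factor \<open>inv a\<close> of the commutator moves that set into \<open>A\<close>, which yields
  two sets for each generator.\<close>

lemma three_system_schottky:
  assumes s: "n_system G X \<phi> 3 A Y a b"
  obtains U where
    "schottky {..<2} (\<lambda>i. commutator G a (inv b (Suc i) \<otimes> b 0)) U"
    "\<forall>x\<in>{..<2} \<times> UNIV. openin X (U x)"
proof -
  note sys = n_systemD[OF s]
  let ?I = "{..<2::nat}"
  \<comment> \<open>Normalized by \<open>b 0\<close>, the other two translates of \<open>A\<close>
    become disjoint from \<open>A\<close> itself; hence the shift \<open>Suc i\<close>.\<close>
  define c where "c i = inv b 0 \<otimes> b (Suc i)" for i
  define f where "f i = commutator G a (inv b (Suc i) \<otimes> b 0)" for i
  define U where "U x = (if snd x then \<phi> (inv a) ` \<phi> (c (fst x)) ` A else \<phi> (c (fst x)) ` A)" for x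
  have AX: "A \<subseteq> topspace X" using sys(5,6) by blast
  have b0: "b 0 \<in> carrier G" "\<phi> (b 0) ` Y = Y" using sys(10,11)[of 0] by simp_all
  have c: "c i \<in> carrier G" "\<phi> (c i) ` Y = Y" "\<phi> (c i) ` A \<subseteq> Y - A"
    "f i = inv a \<otimes> (c i \<otimes> a \<otimes> inv c i)" "inv f i = c i \<otimes> inv a \<otimes> inv c i \<otimes> a"
    if i: "i \<in> ?I" for i
  proof -
    have bi: "b (Suc i) \<in> carrier G" "\<phi> (b (Suc i)) ` Y = Y" "\<phi> (b (Suc i)) ` A \<subseteq> Y"
      "\<phi> (b 0) ` A \<inter> \<phi> (b (Suc i)) ` A = {}"
      using sys(10,11,14)[of "Suc i"] sys(12)[of 0 "Suc i"] i by simp_all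
    show "c i \<in> carrier G"
      using b0 bi by (simp add: c_def)
    show "\<phi> (c i) ` Y = Y"
      using act_mult[OF sys(6), of "inv b 0" "b (Suc i)"] act_inv_invariant[OF b0(1) sys(6) b0(2)] b0 bi
      by (simp add: c_def)
    have "\<phi> (b (Suc i)) ` A \<subseteq> Y - \<phi> (b 0) ` A"
      using bi by blast
    then have "\<phi> (inv b 0) ` \<phi> (b (Suc i)) ` A \<subseteq> Y - A"
      using act_inv_complement[OF b0(1) sys(6) b0(2) sys(5)] by (metis image_mono)
    then show "\<phi> (c i) ` A \<subseteq> Y - A"
      using act_mult[OF AX, of "inv b 0" "b (Suc i)"] b0 bi by (simp add: c_def)
    show f: "f i = inv a \<otimes> (c i \<otimes> a \<otimes> inv c i)"
      using b0 bi sys(7) by (simp add: f_def commutator_def c_def inv_mult_group m_assoc)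
    then show "inv f i = c i \<otimes> inv a \<otimes> inv c i \<otimes> a"
      using \<open>c i \<in> carrier G\<close> sys(7) by (simp add: inv_mult_group m_assoc)
  qed
  note maps = complement_image_subset[OF sys(7,6,5,8,9)]
  have ia: "inv a \<in> carrier G" using sys(7) by simp
  have cX: "\<phi> (c i) ` A \<subseteq> topspace X" if "i \<in> ?I" for i
    using c(3)[OF that] sys(6) by blast
  have attract: "\<phi> (inv a) ` \<phi> (c i) ` A \<subseteq> A" if "i \<in> ?I" for i
    using image_mono[OF c(3)[OF that], of "\<phi> (inv a)"] maps(2) by (rule order_trans)
  have c_disjoint: "\<phi> (c i) ` A \<inter> \<phi> (c j) ` A = {}" if ij: "i \<in> ?I" "j \<in> ?I" "i \<noteq> j" for i j
  proof -
    have "\<phi> (b (Suc i)) ` A \<inter> \<phi> (b (Suc j)) ` A = {}"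
      using sys(12)[of "Suc i" "Suc j"] ij by simp
    then have "\<phi> (inv b 0) ` \<phi> (b (Suc i)) ` A \<inter> \<phi> (inv b 0) ` \<phi> (b (Suc j)) ` A = {}"
      using act_Int[of "inv b 0" "\<phi> (b (Suc i)) ` A" "\<phi> (b (Suc j)) ` A"] b0(1)
        act_subset_topspace[OF _ AX] sys(10)[of "Suc i"] sys(10)[of "Suc j"] ij by simp
    then show ?thesis
      using act_mult[OF AX, of "inv b 0"] b0(1) sys(10)[of "Suc i"] sys(10)[of "Suc j"] ij
      by (simp add: c_def)
  qed
  have "schottky ?I f U"
  proof (rule schottkyI)
    show "f \<in> ?I \<rightarrow> carrier G"
      using c(1,4) sys(7) by simp
    show "Y \<subseteq> topspace X" by (rule sys(6))
    fix x :: "nat \<times> bool" assume x: "x \<in> ?I \<times> UNIV"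
    obtain i d where id: "x = (i, d)" "i \<in> ?I" using x by auto
    show "U x \<subseteq> Y"
      using attract[OF id(2)] c(3)[OF id(2)] sys(5) id(1) by (auto simp: U_def)
    show "U x \<noteq> {}"
      using sys(3) by (simp add: U_def)
    show "\<phi> (letter_val G f x) ` (Y - U (flip x)) \<subseteq> U x"
    proof (cases d)
      case True
      have "\<phi> (c i \<otimes> a \<otimes> inv c i) ` (Y - \<phi> (c i) ` A) \<subseteq> \<phi> (c i) ` A"
        by (rule conjugate_image_subset[OF sys(7) c(1)[OF id(2)] c(1)[OF id(2)] sys(6,5) maps(1) c(2)[OF id(2)]])
      then have "\<phi> (f i) ` (Y - \<phi> (c i) ` A) \<subseteq> \<phi> (inv a) ` \<phi> (c i) ` A"
        unfolding c(4)[OF id(2)]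
        by (rule act_mult_subset[OF _ subset_refl]) (use c(1)[OF id(2)] sys(6,7) in auto)
      then show ?thesis
        using True id by (simp add: U_def letter_val_def)
    next
      case False
      \<comment> \<open>The complement rule is applied to \<open>inv a\<close>, whose inverse is
        \<open>a\<close>.\<close>
      have "\<phi> a ` (Y - \<phi> (inv a) ` \<phi> (c i) ` A) \<subseteq> Y - \<phi> (c i) ` A"
        using act_inv_complement[OF ia sys(6) act_inv_invariant[OF sys(7,6,9)], of "\<phi> (c i) ` A"]
          c(3)[OF id(2)] sys(7) by auto
      moreover have "\<phi> (c i \<otimes> inv a \<otimes> inv c i) ` (Y - \<phi> (c i) ` A) \<subseteq> \<phi> (c i) ` A"
        by (rule conjugate_image_subset[OF ia c(1)[OF id(2)] c(1)[OF id(2)] sys(6,5) maps(2) c(2)[OF id(2)]])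
      ultimately have "\<phi> (inv f i) ` (Y - \<phi> (inv a) ` \<phi> (c i) ` A) \<subseteq> \<phi> (c i) ` A"
        unfolding c(5)[OF id(2)]
        by (rule act_mult_subset) (use c(1)[OF id(2)] sys(6,7) in auto)
      then show ?thesis
        using False id by (simp add: U_def letter_val_def)
    qed
    fix y :: "nat \<times> bool" assume "y \<in> ?I \<times> UNIV" "x \<noteq> y"
    then obtain j e where je: "y = (j, e)" "j \<in> ?I" "i \<noteq> j \<or> d \<noteq> e" using id(1) by auto
    \<comment> \<open>Sets of opposite sign are separated by \<open>A\<close>: the attracting sets
      of the generators lie inside it, those of the inverses outside.\<close>
    have separated: "S \<inter> T = {}" "T \<inter> S = {}" if "S \<subseteq> A" "T \<subseteq> Y - A" for S T
      using that by blast+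
    have "\<phi> (inv a) ` \<phi> (c i) ` A \<inter> \<phi> (inv a) ` \<phi> (c j) ` A = {}" if "i \<noteq> j"
      using act_Int[OF ia cX[OF id(2)] cX[OF je(2)]] c_disjoint[OF id(2) je(2) that] by simp
    moreover have "\<phi> (inv a) ` \<phi> (c i) ` A \<inter> \<phi> (c j) ` A = {}"
      using attract[OF id(2)] c(3)[OF je(2)] by (rule separated(1))
    moreover have "\<phi> (c i) ` A \<inter> \<phi> (inv a) ` \<phi> (c j) ` A = {}"
      using attract[OF je(2)] c(3)[OF id(2)] by (rule separated(2))
    ultimately show "U x \<inter> U y = {}"
      using c_disjoint[OF id(2) je(2)] je(3) by (cases d; cases e;
          simp only: U_def id(1) je(1) fst_conv snd_conv if_True if_False simp_thms)
  qed
  moreover have "openin X (U x)" if "x \<in> ?I \<times> UNIV" for x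
    using that c(1)[of "fst x"] ia sys(2) by (auto simp: U_def intro!: act_open)
  ultimately show thesis
    using that unfolding f_def by blast
qed


section \<open>Ping-pong pairs\<close>

lemma ping_pong_schottky:
  assumes "ping_pong G X \<phi> f1 f2 U0 U1p U1m U2p U2m"
  obtains f U where "schottky {..<2::nat} f U" "openin X U0" "U0 \<noteq> {}"
    "\<forall>x\<in>{..<2} \<times> UNIV. U0 \<inter> U x = {}"
    "\<forall>x\<in>{..<2} \<times> UNIV. \<phi> (letter_val G f x) ` U0 \<subseteq> U x"
proof -
  let ?V = "[U0, U1p, U1m, U2p, U2m]"
  define f where "f i = (if i = 0 then f1 else f2)" for i :: nat
  \<comment> \<open>Position 0 of the list is reserved for the base set \<open>U0\<close>; the
    letters occupy positions 1 to 4.\<close>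
  define r :: "nat \<times> bool \<Rightarrow> nat" where "r x = 2 * fst x + (if snd x then 1 else 2)" for x
  have I: "{..<2::nat} \<times> (UNIV :: bool set) = {(0, True), (0, False), (Suc 0, True), (Suc 0, False)}"
    by (auto simp: UNIV_bool less_2_cases_iff)
  have r_bounds: "r x < 5" "r x \<noteq> 0" if "x \<in> {..<2} \<times> UNIV" for x
    using that by (auto simp: r_def less_2_cases_iff)
  have r_inj: "r x \<noteq> r y" if "x \<in> {..<2} \<times> UNIV" "y \<in> {..<2} \<times> UNIV" "x \<noteq> y" for x y
    using inj_on_letter_index[of 1 2 "{x, y}"] that(3) by (simp add: r_def inj_on_eq_iff)
  have V: "openin X (?V ! i)" "?V ! i \<noteq> {}" if "i < 5" for i
  proof -
    have "\<forall>U\<in>set ?V. openin X U \<and> U \<noteq> {}"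
      using assms[unfolded ping_pong_def, THEN conjunct2, THEN conjunct2, THEN conjunct1] by simp
    then have "openin X (?V ! i) \<and> ?V ! i \<noteq> {}"
      by (rule bspec[OF _ nth_mem]) (use that in simp)
    then show "openin X (?V ! i)" "?V ! i \<noteq> {}" by simp_all
  qed
  have disjoint: "?V ! i \<inter> ?V ! j = {}" if "i < 5" "j < 5" "i \<noteq> j" for i j
    using assms[unfolded ping_pong_def, THEN conjunct2, THEN conjunct2, THEN conjunct2, THEN conjunct1]
      that unfolding disjoint_family_on_def by simp
  have img: "\<phi> f1 ` (U0 \<union> U1p \<union> U2p \<union> U2m) \<subseteq> U1p" "\<phi> (inv f1) ` (U0 \<union> U1m \<union> U2p \<union> U2m) \<subseteq> U1m"
    "\<phi> f2 ` (U0 \<union> U2p \<union> U1p \<union> U1m) \<subseteq> U2p" "\<phi> (inv f2) ` (U0 \<union> U2m \<union> U1p \<union> U1m) \<subseteq> U2m"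
    using assms by (simp_all only: ping_pong_def)
  have letters: "letter_val G f (0, True) = f1" "letter_val G f (0, False) = inv f1"
    "letter_val G f (Suc 0, True) = f2" "letter_val G f (Suc 0, False) = inv f2"
    by (simp_all add: letter_val_def f_def)
  have V_r: "?V ! r (0, True) = U1p" "?V ! r (0, False) = U1m"
    "?V ! r (Suc 0, True) = U2p" "?V ! r (Suc 0, False) = U2m"
    by (simp_all add: r_def)
  have maps: "\<phi> (letter_val G f x) ` (U0 \<union> U y) \<subseteq> U x"
    if "x \<in> {..<2} \<times> UNIV" "y \<in> {..<2} \<times> UNIV" "y \<noteq> flip x" "U = (\<lambda>x. ?V ! r x)" for x y U
    using that(1-3) unfolding I that(4)
    by (elim insertE emptyE) (simp_all add: letters V_r img[unfolded image_Un Un_subset_iff] image_Un)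
  have sub: "?V ! r x \<subseteq> topspace X" if "x \<in> {..<2} \<times> UNIV" for x
    using V(1)[OF r_bounds(1)[OF that]] by (rule openin_subset)
  have "schottky {..<2} f (\<lambda>x. ?V ! r x)"
    unfolding schottky_def disjoint_family_on_def
  proof (intro conjI ballI impI)
    show "f \<in> {..<2} \<rightarrow> carrier G"
      using assms by (simp add: f_def ping_pong_def)
    fix x :: "nat \<times> bool" assume x: "x \<in> {..<2} \<times> UNIV"
    show "?V ! r x \<subseteq> topspace X" "?V ! r x \<noteq> {}"
      by (rule sub[OF x], rule V(2)[OF r_bounds(1)[OF x]])
    fix y :: "nat \<times> bool" assume y: "y \<in> {..<2} \<times> UNIV"
    show "?V ! r x \<inter> ?V ! r y = {}" if "x \<noteq> y"
      by (rule disjoint[OF r_bounds(1)[OF x] r_bounds(1)[OF y] r_inj[OF x y that]])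
    show "\<phi> (letter_val G f x) ` (?V ! r y) \<subseteq> ?V ! r x" if "y \<noteq> flip x"
      using maps[OF x y that HOL.refl] unfolding image_Un by (rule le_supE)
  qed
  moreover have "U0 \<inter> ?V ! r x = {}" if "x \<in> {..<2} \<times> UNIV" for x
    using disjoint[of 0 "r x"] r_bounds[OF that] by simp
  moreover have "\<phi> (letter_val G f x) ` U0 \<subseteq> ?V ! r x" if "x \<in> {..<2} \<times> UNIV" for x
  proof -
    \<comment> \<open>Taking \<open>y = x\<close> in \<open>maps\<close> is therefore allowed, and
      its part about \<open>U0\<close> remains.\<close>
    have "x \<noteq> flip x" by (cases x) simp
    then show ?thesis
      using maps[OF that that _ HOL.refl] unfolding image_Un by (blast elim: le_supE)
  qed
  ultimately show thesis
    using that[of f "\<lambda>x. ?V ! r x"] V[of 0] by simp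
qed

lemma disjoint_family_on_list5:
  assumes "A \<inter> B = {}" "A \<inter> C = {}" "A \<inter> D = {}" "A \<inter> E = {}" "B \<inter> C = {}" "B \<inter> D = {}"
    "B \<inter> E = {}" "C \<inter> D = {}" "C \<inter> E = {}" "D \<inter> E = {}"
  shows "disjoint_family_on ((!) [A, B, C, D, E]) {..<5}"
proof -
  have "{..<5::nat} = {0, 1, 2, 3, 4}" by auto
  then show ?thesis
    using assms by (simp add: disjoint_family_on_def Int_commute)
qed

text \<open>
  A Schottky pair need not leave room for a base set; replacing the first element by its square
  frees the part of \<open>U (0, False)\<close> that is the image of \<open>U (1, True)\<close> under the inverse of \<open>f 0\<close>.
\<close>

lemma schottky_ping_pong:
  fixes f :: "nat \<Rightarrow> 'g"
  assumes U: "schottky {..<2} f U" and "\<forall>x\<in>{..<2} \<times> UNIV. openin X (U x)"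
  shows "\<exists>f1 f2 U0 U1p U1m U2p U2m. ping_pong G X \<phi> f1 f2 U0 U1p U1m U2p U2m"
proof -
  let ?f1 = "f 0" and ?f2 = "f (1::nat)"
  let ?U1p = "U (0, True)" and ?U1m = "U (0, False)" and ?U2p = "U (1, True)" and ?U2m = "U (1, False)"
  let ?g = "inv f 0"
  have f: "?f1 \<in> carrier G" "?f2 \<in> carrier G" "?g \<in> carrier G" using schottkyD(1)[OF U] by auto
  have open_U: "openin X ?U1p" "openin X ?U1m" "openin X ?U2p" "openin X ?U2m"
    using assms(2) by simp_all
  note sub = open_U[THEN openin_subset]
  have ne: "?U1p \<noteq> {}" "?U1m \<noteq> {}" "?U2p \<noteq> {}" "?U2m \<noteq> {}"
    using schottkyD(3)[OF U] by simp_all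
  have dj: "?U1p \<inter> ?U1m = {}" "?U1p \<inter> ?U2p = {}" "?U1p \<inter> ?U2m = {}" "?U1m \<inter> ?U2p = {}"
    "?U1m \<inter> ?U2m = {}" "?U2p \<inter> ?U2m = {}"
    using schottkyD(4)[OF U] by simp_all
  have p1: "\<phi> ?f1 ` ?U1p \<subseteq> ?U1p" "\<phi> ?f1 ` ?U2p \<subseteq> ?U1p" "\<phi> ?f1 ` ?U2m \<subseteq> ?U1p"
    using schottkyD(5)[OF U, of "(0, True)" "(0, True)"] schottkyD(5)[OF U, of "(0, True)" "(1, True)"]
      schottkyD(5)[OF U, of "(0, True)" "(1, False)"] by (simp_all add: letter_val_def)
  have m1: "\<phi> ?g ` ?U1m \<subseteq> ?U1m" "\<phi> ?g ` ?U2p \<subseteq> ?U1m" "\<phi> ?g ` ?U2m \<subseteq> ?U1m"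
    using schottkyD(5)[OF U, of "(0, False)" "(0, False)"] schottkyD(5)[OF U, of "(0, False)" "(1, True)"]
      schottkyD(5)[OF U, of "(0, False)" "(1, False)"] by (simp_all add: letter_val_def)
  have p2: "\<phi> ?f2 ` ?U2p \<subseteq> ?U2p" "\<phi> ?f2 ` ?U1p \<subseteq> ?U2p" "\<phi> ?f2 ` ?U1m \<subseteq> ?U2p"
    using schottkyD(5)[OF U, of "(1, True)" "(1, True)"] schottkyD(5)[OF U, of "(1, True)" "(0, True)"]
      schottkyD(5)[OF U, of "(1, True)" "(0, False)"] by (simp_all add: letter_val_def)
  have m2: "\<phi> (inv ?f2) ` ?U2m \<subseteq> ?U2m" "\<phi> (inv ?f2) ` ?U1p \<subseteq> ?U2m" "\<phi> (inv ?f2) ` ?U1m \<subseteq> ?U2m"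
    using schottkyD(5)[OF U, of "(1, False)" "(1, False)"] schottkyD(5)[OF U, of "(1, False)" "(0, True)"]
      schottkyD(5)[OF U, of "(1, False)" "(0, False)"] by (simp_all add: letter_val_def)
  define U0 where "U0 = \<phi> ?g ` ?U2p"
  define V1m where "V1m = \<phi> ?g ` ?U1m"
  have U0: "U0 \<subseteq> ?U1m" and V1m: "V1m \<subseteq> ?U1m" using m1 by (simp_all add: U0_def V1m_def)
  \<comment> \<open>These are the images of the disjoint sets \<open>U (1, True)\<close> and
    \<open>U (0, False)\<close> under the same injective map.\<close>
  have U0_V1m: "U0 \<inter> V1m = {}"
    using act_Int[OF f(3) sub(3,2)] dj(4) unfolding U0_def V1m_def by (simp add: Int_commute)
  \<comment> \<open>One application of \<open>f 0\<close> brings the base set only to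
    \<open>U (1, True)\<close>; the second brings it into \<open>U (0, True)\<close>. This is why
    the square is taken.\<close>
  have pull: "\<phi> ?f1 ` U0 = ?U2p"
    using act_inv[OF f(3) sub(3)] f(1) by (simp add: U0_def)
  have sq: "\<phi> (?f1 \<otimes> ?f1) ` S \<subseteq> ?U1p" if "\<phi> ?f1 ` S \<subseteq> ?U1p \<union> ?U2p" "S \<subseteq> topspace X" for S
    by (rule act_mult_subset[OF that(1) _ that(2) f(1,1)]) (use p1 in \<open>simp add: image_Un\<close>)
  \<comment> \<open>The first inverse factor reaches \<open>U (0, False)\<close>, and the second
    shrinks the result into \<open>V1m\<close>.\<close>
  have inv_sq: "\<phi> (inv (?f1 \<otimes> ?f1)) ` S \<subseteq> V1m" if "\<phi> ?g ` S \<subseteq> ?U1m" "S \<subseteq> topspace X" for S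
    unfolding inv_mult_group[OF f(1,1)] V1m_def
    by (rule act_mult_subset[OF that(1) subset_refl that(2) f(3,3)])
  \<comment> \<open>Both \<open>U0\<close> and \<open>V1m\<close> inherit the inclusions known for
    \<open>U (0, False)\<close>; in particular the second generator is kept unchanged.\<close>
  have inside: "\<phi> h ` S \<subseteq> T" if "\<phi> h ` ?U1m \<subseteq> T" "S \<subseteq> ?U1m" for h S T
    using that by (meson image_mono order_trans)
  have "ping_pong G X \<phi> (?f1 \<otimes> ?f1) ?f2 U0 ?U1p V1m ?U2p ?U2m"
    unfolding ping_pong_def
  proof (intro conjI)
    show "?f1 \<otimes> ?f1 \<in> carrier G" "?f2 \<in> carrier G" using f by simp_all
    show "\<forall>U\<in>{U0, ?U1p, V1m, ?U2p, ?U2m}. openin X U \<and> U \<noteq> {}"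
      using open_U ne act_open[OF f(3)] by (simp add: U0_def V1m_def)
    have m: "?U1m \<inter> ?U1p = {}" "?U1m \<inter> ?U2p = {}" "?U1m \<inter> ?U2m = {}"
      using dj by (simp_all add: Int_commute)
    have *: "S \<inter> T = {}" "T \<inter> S = {}" if "S \<subseteq> ?U1m" "?U1m \<inter> T = {}" for S T
      using that by blast+
    show "disjoint_family_on ((!) [U0, ?U1p, V1m, ?U2p, ?U2m]) {..<5}"
      by (rule disjoint_family_on_list5[OF *(1)[OF U0 m(1)] U0_V1m *(1)[OF U0 m(2)] *(1)[OF U0 m(3)]
            *(2)[OF V1m m(1)] dj(2,3) *(1)[OF V1m m(2)] *(1)[OF V1m m(3)] dj(6)])
    show "\<phi> (?f1 \<otimes> ?f1) ` (U0 \<union> ?U1p \<union> ?U2p \<union> ?U2m) \<subseteq> ?U1p"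
      using U0 sub p1 by (intro sq) (simp_all add: image_Un pull le_supI1)
    show "\<phi> (inv (?f1 \<otimes> ?f1)) ` (U0 \<union> V1m \<union> ?U2p \<union> ?U2m) \<subseteq> V1m"
      by (rule inv_sq, unfold image_Un)
        (intro Un_least inside[OF m1(1) U0] inside[OF m1(1) V1m] m1(2,3) sub(3,4)
          order_trans[OF U0 sub(2)] order_trans[OF V1m sub(2)])+
    show "\<phi> ?f2 ` (U0 \<union> ?U2p \<union> ?U1p \<union> V1m) \<subseteq> ?U2p"
      unfolding image_Un by (intro Un_least inside[OF p2(3) U0] inside[OF p2(3) V1m] p2(1,2))
    show "\<phi> (inv ?f2) ` (U0 \<union> ?U2m \<union> ?U1p \<union> V1m) \<subseteq> ?U2m"
      unfolding image_Un by (intro Un_least inside[OF m2(3) U0] inside[OF m2(3) V1m] m2(1,2))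
  qed
  then show ?thesis by blast
qed

lemma five_system_ping_pong:
  assumes s: "n_system G X \<phi> 5 A Y a b"
  shows "ping_pong G X \<phi> (b 1 \<otimes> a \<otimes> inv (b 2)) (b 3 \<otimes> a \<otimes> inv (b 4))
    (\<phi> (b 0) ` A) (\<phi> (b 1) ` A) (\<phi> (b 2) ` A) (\<phi> (b 3) ` A) (\<phi> (b 4) ` A)"
proof -
  note sys = n_systemD[OF s]
  define f where "f i = b (2 * i + 1) \<otimes> a \<otimes> inv b (2 * i + 2)" for i
  define r :: "nat \<times> bool \<Rightarrow> nat" where "r x = 2 * fst x + (if snd x then 1 else 2)" for x
  let ?B = "\<lambda>i. \<phi> (b i) ` A"
  have r: "r x < 5" if "x \<in> {..<2} \<times> UNIV" for x
    using that by (auto simp: r_def less_2_cases_iff)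
  have maps: "\<phi> (letter_val G f x) ` (Y - ?B (r (flip x))) \<subseteq> ?B (r x)" if "x \<in> {..<2} \<times> UNIV" for x
    using s r _ that by (rule n_system_letter_val) (simp_all add: f_def r_def)
  have letters: "\<phi> (f 0) ` (Y - ?B 2) \<subseteq> ?B 1" "\<phi> (inv f 0) ` (Y - ?B 1) \<subseteq> ?B 2"
    "\<phi> (f 1) ` (Y - ?B 4) \<subseteq> ?B 3" "\<phi> (inv f 1) ` (Y - ?B 3) \<subseteq> ?B 4"
    using maps[of "(0, True)"] maps[of "(0, False)"] maps[of "(1, True)"] maps[of "(1, False)"]
    by (simp_all add: letter_val_def r_def numeral_2_eq_2[symmetric])
  \<comment> \<open>Each of the four unions consists of all five translates except one, so it lies
    in the complement of the omitted translate.\<close>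
  have *: "\<phi> g ` (?B i \<union> ?B j \<union> ?B k \<union> ?B l) \<subseteq> T"
    if "\<phi> g ` (Y - ?B m) \<subseteq> T" "i < 5" "j < 5" "k < 5" "l < 5" "m < 5" "m \<notin> {i, j, k, l}" for g i j k l m T
  proof -
    have "?B i \<subseteq> Y - ?B m" if "i < 5" "i \<noteq> m" for i
      using sys(12)[OF that(1) \<open>m < 5\<close> that(2)] sys(14)[OF that(1)] by blast
    then have "?B i \<union> ?B j \<union> ?B k \<union> ?B l \<subseteq> Y - ?B m"
      using that by simp
    then show ?thesis
      using that(1) by (meson image_mono order_trans)
  qed
  have f: "f 0 \<in> carrier G" "f 1 \<in> carrier G" "f 0 = b 1 \<otimes> a \<otimes> inv (b 2)" "f 1 = b 3 \<otimes> a \<otimes> inv (b 4)"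
    using sys(7,10) by (simp_all add: f_def numeral_2_eq_2[symmetric])
  have "ping_pong G X \<phi> (f 0) (f 1) (?B 0) (?B 1) (?B 2) (?B 3) (?B 4)"
    unfolding ping_pong_def
  proof (intro conjI)
    show "f 0 \<in> carrier G" "f 1 \<in> carrier G" by fact+
    show "\<forall>U\<in>{?B 0, ?B 1, ?B 2, ?B 3, ?B 4}. openin X U \<and> U \<noteq> {}"
      using sys(3,13) by simp
    show "disjoint_family_on ((!) [?B 0, ?B 1, ?B 2, ?B 3, ?B 4]) {..<5}"
      using sys(12) by (intro disjoint_family_on_list5) simp_all
    show "\<phi> (f 0) ` (?B 0 \<union> ?B 1 \<union> ?B 3 \<union> ?B 4) \<subseteq> ?B 1"
      by (rule *[OF letters(1)]) simp_all
    show "\<phi> (inv f 0) ` (?B 0 \<union> ?B 2 \<union> ?B 3 \<union> ?B 4) \<subseteq> ?B 2"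
      by (rule *[OF letters(2)]) simp_all
    show "\<phi> (f 1) ` (?B 0 \<union> ?B 3 \<union> ?B 1 \<union> ?B 2) \<subseteq> ?B 3"
      by (rule *[OF letters(3)]) simp_all
    show "\<phi> (inv f 1) ` (?B 0 \<union> ?B 4 \<union> ?B 1 \<union> ?B 2) \<subseteq> ?B 4"
      by (rule *[OF letters(4)]) simp_all
  qed
  then show ?thesis unfolding f(3,4) .
qed


section \<open>From a free group to systems\<close>

text \<open>
  In the free group on two letters, let \<open>B\<close> be the set of reduced words that begin with a power of
  the letter \<open>0\<close>. Then \<open>B\<close> and its translate by the letter \<open>0\<close> cover the group, while the
  translates of \<open>B\<close> by the powers of the letter \<open>1\<close> are pairwise disjoint.
\<close>

lemma free_group_n_systems:
  assumes F: "subgroup F G" and free: "free_of_rank (G\<lparr>carrier := F\<rparr>) 2"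
    and Z: "Z \<noteq> {}" "openin X Z" and pd: "properly_discontinuous_on G X \<phi> F Z"
  shows "\<exists>A Y. openin X A \<and> A \<noteq> {} \<and> openin X Y \<and> Y \<noteq> {} \<and> A \<subseteq> Y \<and>
    (\<forall>n\<ge>3. \<exists>a b. n_system G X \<phi> n A Y a b)"
proof -
  note [simp] = subgroup.mem_carrier[OF F] subgroup.m_closed[OF F] subgroup.m_inv_closed[OF F]
  let ?W = "words {..<2::nat}"
  have ZX: "Z \<subseteq> topspace X" using Z(2) by (rule openin_subset)
  have top: "topspace (subtopology X Z) = Z" using ZX by auto
  obtain z where "z \<in> Z" using Z(1) by blast
  then obtain U where U_sub: "openin (subtopology X Z) U" and zU: "z \<in> U"
    and U_free: "\<forall>h\<in>F. h \<noteq> \<one> \<longrightarrow> restrict (\<phi> h) Z ` U \<inter> U = {}"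
    using pd unfolding properly_discontinuous_on_def properly_discontinuous_action_def top by auto
  have U: "openin X U" "U \<subseteq> Z"
    using U_sub Z(2) by (simp_all add: openin_open_subtopology)
  have UX: "U \<subseteq> topspace X" using U(1) by (rule openin_subset)
  have disj: "\<phi> g ` U \<inter> \<phi> h ` U = {}" if gh: "g \<in> F" "h \<in> F" "g \<noteq> h" for g h
  proof -
    \<comment> \<open>Disjointness of two translates reduces to the quotient of the two group
      elements, which moves \<open>U\<close> off itself.\<close>
    let ?k = "inv g \<otimes> h"
    have "?k \<noteq> \<one>"
    proof
      assume "?k = \<one>"
      then have "g \<otimes> ?k = g" using gh by simp
      then show False using gh by (simp add: m_assoc[symmetric])
    qed
    moreover have "restrict (\<phi> ?k) Z ` U = \<phi> ?k ` U"
      using U(2) by (intro image_cong) auto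
    ultimately have "\<phi> ?k ` U \<inter> U = {}"
      using U_free gh by (metis subgroup.m_closed[OF F] subgroup.m_inv_closed[OF F])
    moreover have "\<phi> g ` \<phi> ?k ` U = \<phi> h ` U"
      using act_mult[OF UX, of g ?k] gh by (simp add: m_assoc[symmetric])
    ultimately show ?thesis
      using act_Int[of g "\<phi> ?k ` U" U] act_subset_topspace[OF _ UX, of ?k] UX gh
      by (simp add: Int_commute)
  qed
  obtain e where e: "e ` ?W = F"
    and e_append: "\<And>u v. u \<in> ?W \<Longrightarrow> v \<in> ?W \<Longrightarrow> e (u @ v) = e u \<otimes> e v"
    and e_eq: "\<And>u v. u \<in> ?W \<Longrightarrow> v \<in> ?W \<Longrightarrow> e u = e v \<longleftrightarrow> norm_word u = norm_word v"
    using free_of_rank_evaluation[OF free] by blast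
  have eF: "e u \<in> F" if "u \<in> ?W" for u using e that by blast
  define B where "B = {u \<in> ?W. norm_word u \<noteq> [] \<and> fst (hd (norm_word u)) = 0}"
  define A where "A = translates \<phi> (e ` B) U"
  define Y where "Y = translates \<phi> F U"
  define a where "a = e [(0, True)]"
  \<comment> \<open>All powers are fixed at once, so \<open>A\<close> and \<open>Y\<close> do not
    depend on \<open>n\<close>.\<close>
  define b where "b n = e (replicate n (1, True))" for n
  have B: "B \<subseteq> ?W" by (auto simp: B_def)
  have rep: "replicate n (1, True) \<in> ?W" for n by auto
  have translate: "\<phi> (e u) ` A = (\<Union>v\<in>B. \<phi> (e (u @ v)) ` U)" if u: "u \<in> ?W" for u
  proof -
    have "\<phi> (e u) ` \<phi> (e v) ` U = \<phi> (e (u @ v)) ` U" if "v \<in> B" for v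
    proof -
      have v: "v \<in> ?W" using B that by blast
      show ?thesis
        unfolding e_append[OF u v] using act_mult[OF UX] eF[OF u] eF[OF v] by simp
    qed
    then show ?thesis
      unfolding A_def translates_def image_UN by simp
  qed
  have "\<phi> (e w) ` U \<subseteq> A \<union> \<phi> a ` A" if w: "w \<in> ?W" for w
  proof (cases "w \<in> B")
    case True
    then show ?thesis by (auto simp: A_def translates_def)
  next
    case False
    \<comment> \<open>The normal form of \<open>w\<close> is empty or starts with the letter 1, so
      the prefixed inverse of the letter 0 does not cancel and \<open>v\<close> lies in
      \<open>B\<close>. Multiplying \<open>v\<close> by the letter 0 gives back the element of
      \<open>w\<close>.\<close>
    define v where "v = (0, False) # w"
    have "norm_word v = (0, False) # norm_word w"
      using False w by (auto simp: v_def norm_word_Cons push_def B_def)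
    then have "v \<in> B"
      using w by (simp add: B_def v_def)
    have av: "[(0, True)] @ v \<in> ?W"
      using w by (simp add: v_def)
    have "norm_word ([(0, True)] @ v) = norm_word w"
      using push_push_flip[OF reduced_norm_word, of "(0, True)" w] by (simp add: v_def norm_word_Cons)
    then have "e ([(0, True)] @ v) = e w"
      using e_eq[OF av w] by simp
    then have "\<phi> (e w) ` U = \<phi> (e ([(0, True)] @ v)) ` U" by simp
    also have "\<dots> \<subseteq> (\<Union>v\<in>B. \<phi> (e ([(0, True)] @ v)) ` U)"
      using \<open>v \<in> B\<close> by (rule UN_upper)
    also have "\<dots> = \<phi> a ` A"
      unfolding a_def by (rule translate[symmetric]) simp
    finally show ?thesis by (rule le_supI2)
  qed
  then have "Y \<subseteq> A \<union> \<phi> a ` A"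
    unfolding Y_def translates_def e[symmetric] by (intro UN_least) (erule imageE, simp)
  have eB: "e ` B \<subseteq> F" using B e by blast
  then have AY: "A \<subseteq> Y"
    unfolding A_def Y_def translates_def by (rule UN_mono) simp
  have inv: "\<phi> f ` Y = Y" if "f \<in> F" for f
    unfolding Y_def using F UX that by (rule translates_subgroup_invariant)
  have aF: "a \<in> F" unfolding a_def by (rule eF) simp
  have bF: "b n \<in> F" for n unfolding b_def by (rule eF[OF rep])
  have "\<phi> a ` A \<subseteq> Y"
    using image_mono[OF AY] inv[OF aF] by metis
  then have cover: "Y = A \<union> \<phi> a ` A"
    using \<open>Y \<subseteq> A \<union> \<phi> a ` A\<close> AY by blast
  have b_disjoint: "\<phi> (b i) ` A \<inter> \<phi> (b j) ` A = {}" if "i \<noteq> j" for i j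
  proof -
    have "\<phi> (e (replicate i (1, True) @ u)) ` U \<inter> \<phi> (e (replicate j (1, True) @ v)) ` U = {}"
      if uv: "u \<in> B" "v \<in> B" for u v
    proof (rule disj)
      have W: "replicate i (1, True) @ u \<in> ?W" "replicate j (1, True) @ v \<in> ?W"
        using rep uv B by auto
      then show "e (replicate i (1, True) @ u) \<in> F" "e (replicate j (1, True) @ v) \<in> F"
        by (simp_all only: eF)
      have "norm_word (replicate i (1, True) @ u) = replicate i (1, True) @ norm_word u"
        "norm_word (replicate j (1, True) @ v) = replicate j (1, True) @ norm_word v"
        using uv by (auto simp: B_def intro!: norm_word_replicate)
      \<comment> \<open>Normal forms of words in \<open>B\<close> start with index 0, so the initial
        run of the letter 1 has length exactly \<open>i\<close> or \<open>j\<close>.\<close>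
      moreover have "replicate i (1, True) @ norm_word u \<noteq> replicate j (1, True) @ norm_word v"
        using replicate_append_eq_imp[of i "(1, True)" "norm_word u" j "norm_word v"] uv \<open>i \<noteq> j\<close>
        by (auto simp: B_def)
      ultimately show "e (replicate i (1, True) @ u) \<noteq> e (replicate j (1, True) @ v)"
        using e_eq[OF W] by simp
    qed
    then show ?thesis
      unfolding b_def translate[OF rep] by blast
  qed
  have "[(0, True)] \<in> B" by (simp add: B_def norm_word_def push_def)
  then have "A \<noteq> {}" using zU by (auto simp: A_def translates_def)
  then have "Y \<noteq> {}" using AY by blast
  have "openin X A" "openin X Y"
    unfolding A_def Y_def using U(1) eB subgroup.subset[OF F] by (auto intro!: openin_translates)
  have "n_system G X \<phi> n A Y a b" if "n \<ge> 3" for n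
    unfolding n_system_def disjoint_family_on_def
    by (intro conjI ballI allI impI that \<open>openin X A\<close> \<open>A \<noteq> {}\<close> \<open>openin X Y\<close> \<open>Y \<noteq> {}\<close> AY
        subgroup.mem_carrier[OF F aF] subgroup.mem_carrier[OF F bF] cover b_disjoint inv aF bF)
  then show ?thesis
    using AY \<open>openin X A\<close> \<open>A \<noteq> {}\<close> \<open>openin X Y\<close> \<open>Y \<noteq> {}\<close> by blast
qed


section \<open>Consequences for systems\<close>

lemma three_system_ping_pong:
  assumes "n_system G X \<phi> 3 A Y a b"
  shows "\<exists>f1 f2 U0 U1p U1m U2p U2m. ping_pong G X \<phi> f1 f2 U0 U1p U1m U2p U2m"
proof -
  obtain U where "schottky {..<2} (\<lambda>i. commutator G a (inv b (Suc i) \<otimes> b 0)) U"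
    "\<forall>x\<in>{..<2} \<times> UNIV. openin X (U x)"
    using assms by (rule three_system_schottky)
  then show ?thesis by (rule schottky_ping_pong)
qed

lemma ping_pong_properly_discontinuous:
  assumes pp: "ping_pong G X \<phi> f1 f2 U0 U1p U1m U2p U2m"
  shows "\<exists>F. subgroup F G \<and> free_of_rank (G\<lparr>carrier := F\<rparr>) 2 \<and>
    (\<exists>Z. Z \<noteq> {} \<and> openin X Z \<and> translates \<phi> F Z = Z \<and> properly_discontinuous_on G X \<phi> F Z)"
proof -
  obtain f U where U: "schottky {..<2::nat} f U" "openin X U0" "U0 \<noteq> {}"
    "\<forall>x\<in>{..<2} \<times> UNIV. U0 \<inter> U x = {}"
    "\<forall>x\<in>{..<2} \<times> UNIV. \<phi> (letter_val G f x) ` U0 \<subseteq> U x"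
    by (rule ping_pong_schottky[OF pp])
  define F where "F = generate G (f ` {..<2})"
  define Z where "Z = translates \<phi> F U0"
  note Z = schottky_properly_discontinuous[OF U(1) order_refl U(2) U(4,5)[THEN bspec] F_def Z_def]
  have "\<phi> \<one> ` U0 \<subseteq> Z"
    using subgroup.one_closed[OF Z(1)] by (auto simp: Z_def translates_def)
  then have "Z \<noteq> {}" using U(3) by blast
  then show ?thesis using Z by blast
qed

section \<open>Explicit free generators from systems\<close>

lemma schottky_pair_free:
  fixes f :: "nat \<Rightarrow> 'g"
  assumes "schottky {..<2} f U"
  shows "freely_generates G {f 0, f 1} \<and> free_of_rank (G\<lparr>carrier := generate G {f 0, f 1}\<rparr>) 2"
proof -
  have "{..<2::nat} = {0, 1}" by auto
  then show ?thesis
    using schottky_freely_generates[OF assms, of 0 1] schottky_free_of_rank[OF assms] by simp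
qed

lemma three_system_commutators_free:
  assumes s: "n_system G X \<phi> 3 A Y a b"
    and S: "S = {commutator G a (inv (b 1) \<otimes> b 0), commutator G a (inv (b 2) \<otimes> b 0)}"
  shows "freely_generates G S \<and> free_of_rank (G\<lparr>carrier := generate G S\<rparr>) 2"
proof -
  obtain U where "schottky {..<2} (\<lambda>i. commutator G a (inv b (Suc i) \<otimes> b 0)) U"
    using s by (rule three_system_schottky)
  then show ?thesis
    using schottky_pair_free[of "\<lambda>i. commutator G a (inv b (Suc i) \<otimes> b 0)" U]
    by (simp add: S numeral_2_eq_2)
qed

lemma four_system_free:
  assumes s: "n_system G X \<phi> 4 A Y a b" and S: "S = {b 0 \<otimes> a \<otimes> inv (b 1), b 2 \<otimes> a \<otimes> inv (b 3)}"
  shows "freely_generates G S \<and> free_of_rank (G\<lparr>carrier := generate G S\<rparr>) 2"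
proof -
  \<comment> \<open>The four letters take up the indices 0 to 3, that is, all four
    translates.\<close>
  let ?r = "\<lambda>x::nat \<times> bool. 2 * fst x + (if snd x then 0 else 1)"
  have "schottky {..<2} (\<lambda>i. b (2 * i) \<otimes> a \<otimes> inv b (2 * i + 1)) (\<lambda>x. \<phi> (b (?r x)) ` A)"
  proof (rule n_system_schottky[OF s])
    show "inj_on ?r ({..<2} \<times> UNIV)"
      by (rule inj_on_letter_index) simp
  qed (auto simp: less_2_cases_iff)
  then show ?thesis
    using schottky_pair_free[of "\<lambda>i. b (2 * i) \<otimes> a \<otimes> inv b (2 * i + 1)"]
    by (simp add: S numeral_3_eq_3 numeral_2_eq_2)
qed

lemma n_system_properly_discontinuous:
  assumes s: "n_system G X \<phi> n A Y a b" and k: "2 \<le> k" "2 * k + 1 \<le> n"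
    and F: "F = generate G ((\<lambda>i. b (2 * i - 1) \<otimes> a \<otimes> inv (b (2 * i))) ` {1..k})"
    and Z: "Z = translates \<phi> F (\<phi> (b 0) ` A)"
  shows "free_of_rank (G\<lparr>carrier := F\<rparr>) k \<and> openin X Z \<and> translates \<phi> F Z = Z \<and>
    properly_discontinuous_on G X \<phi> F Z"
proof -
  note sys = n_systemD[OF s]
  let ?f = "\<lambda>i. b (2 * i + 1) \<otimes> a \<otimes> inv b (2 * i + 2)"
  \<comment> \<open>Index 0 stays free for the base set. The largest index used is
    \<open>2 * k\<close>, which is where \<open>2 * k + 1 \<le> n\<close> enters.\<close>
  let ?r = "\<lambda>x::nat \<times> bool. 2 * fst x + (if snd x then 1 else 2)"
  let ?U = "\<lambda>x. \<phi> (b (?r x)) ` A"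
  have r: "?r x < n" "?r x \<noteq> 0" if "x \<in> {..<k} \<times> UNIV" for x
    using k(2) that by auto
  have U: "schottky {..<k} ?f ?U"
  proof (rule n_system_schottky[OF s r(1)])
    show "inj_on ?r ({..<k} \<times> UNIV)"
      by (rule inj_on_letter_index) simp
  qed simp_all
  have n0: "0 < n" using k by simp
  have disjoint: "\<phi> (b 0) ` A \<inter> ?U x = {}" if "x \<in> {..<k} \<times> UNIV" for x
    using sys(12)[OF n0 r(1)[OF that]] r(2)[OF that] by simp
  have maps: "\<phi> (letter_val G ?f x) ` \<phi> (b 0) ` A \<subseteq> ?U x" if x: "x \<in> {..<k} \<times> UNIV" for x
  proof -
    have "flip x \<in> {..<k} \<times> UNIV" using x by (cases x) simp
    then have "\<phi> (b 0) ` A \<subseteq> Y - ?U (flip x)"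
      using disjoint[OF \<open>flip x \<in> {..<k} \<times> UNIV\<close>] sys(14)[OF n0] by blast
    moreover have "\<phi> (letter_val G ?f x) ` (Y - ?U (flip x)) \<subseteq> ?U x"
      by (rule n_system_letter_val[OF s r(1) _ x]) simp_all
    ultimately show ?thesis by (meson image_mono order_trans)
  qed
  \<comment> \<open>Counting generators from 0 instead of 1 turns the indices
    \<open>2 * i - 1\<close> and \<open>2 * i\<close> into \<open>2 * i + 1\<close> and
    \<open>2 * i + 2\<close>.\<close>
  have gens: "?f ` {..<k} = (\<lambda>i. b (2 * i - 1) \<otimes> a \<otimes> inv b (2 * i)) ` {1..k}"
  proof -
    have "{1..k} = Suc ` {..<k}"
      by (simp add: lessThan_atLeast0 atLeastLessThanSuc_atLeastAtMost)
    then show ?thesis by (simp add: image_image)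
  qed
  have F': "F = generate G (?f ` {..<k})"
    unfolding F gens ..
  show ?thesis
    using schottky_properly_discontinuous(2-5)[OF U k(1) sys(13)[OF n0] disjoint maps F' Z] by blast
qed

end

section \<open>The four equivalent conditions and the explicit free subgroups\<close>

theorem theorem1:
  fixes G :: "('g, 'm) monoid_scheme" (structure)
    and X :: "'x topology"
    and \<phi> :: "'g \<Rightarrow> 'x \<Rightarrow> 'x"
  assumes "group G" and "acts_by_homeomorphisms G X \<phi>"
  shows
    "(let
        cond_i = (\<exists>F. subgroup F G \<and> free_of_rank (G\<lparr>carrier := F\<rparr>) 2 \<and>
          (\<exists>Z. Z \<noteq> {} \<and> openin X Z \<and> translates \<phi> F Z = Z \<and>
            properly_discontinuous_on G X \<phi> F Z));
        cond_ii = (\<exists>A Y a b. n_system G X \<phi> 3 A Y a b);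
        cond_iii = (\<exists>A Y. openin X A \<and> A \<noteq> {} \<and> openin X Y \<and> Y \<noteq> {} \<and> A \<subseteq> Y \<and>
          (\<forall>n\<ge>3. \<exists>a b. n_system G X \<phi> n A Y a b));
        cond_iv = (\<exists>f\<^sub>1 f\<^sub>2 U\<^sub>0 U1p U1m U2p U2m. ping_pong G X \<phi> f\<^sub>1 f\<^sub>2 U\<^sub>0 U1p U1m U2p U2m)
      in (cond_i \<longleftrightarrow> cond_ii) \<and> (cond_ii \<longleftrightarrow> cond_iii) \<and> (cond_iii \<longleftrightarrow> cond_iv))
    \<and> (\<forall>A Y a b. n_system G X \<phi> 3 A Y a b \<longrightarrow>
        (let S = {commutator G a (inv (b 1) \<otimes> b 0), commutator G a (inv (b 2) \<otimes> b 0)}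
         in freely_generates G S \<and> free_of_rank (G\<lparr>carrier := generate G S\<rparr>) 2))
    \<and> (\<forall>A Y a b. n_system G X \<phi> 4 A Y a b \<longrightarrow>
        (let S = {b 0 \<otimes> a \<otimes> inv (b 1), b 2 \<otimes> a \<otimes> inv (b 3)}
         in freely_generates G S \<and> free_of_rank (G\<lparr>carrier := generate G S\<rparr>) 2))
    \<and> (\<forall>k n A Y a b. k \<ge> 2 \<longrightarrow> n \<ge> 2 * k + 1 \<longrightarrow> n_system G X \<phi> n A Y a b \<longrightarrow>
        (let F = generate G ((\<lambda>i. b (2 * i - 1) \<otimes> a \<otimes> inv (b (2 * i))) ` {1..k});
             Z = translates \<phi> F (\<phi> (b 0) ` A)
         in free_of_rank (G\<lparr>carrier := F\<rparr>) k \<and>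
            openin X Z \<and> translates \<phi> F Z = Z \<and> properly_discontinuous_on G X \<phi> F Z))
    \<and> (\<forall>A Y a b. n_system G X \<phi> 5 A Y a b \<longrightarrow>
        ping_pong G X \<phi> (b 1 \<otimes> a \<otimes> inv (b 2)) (b 3 \<otimes> a \<otimes> inv (b 4))
          (\<phi> (b 0) ` A) (\<phi> (b 1) ` A) (\<phi> (b 2) ` A) (\<phi> (b 3) ` A) (\<phi> (b 4) ` A))"
    (is "?equivalences \<and> ?three \<and> ?four \<and> ?many \<and> ?five")
proof -
  have H: "homeomorphism_action G X \<phi>"
    using assms by (simp add: homeomorphism_action_def homeomorphism_action_axioms_def
        acts_by_homeomorphisms_def)
  let ?i = "\<exists>F. subgroup F G \<and> free_of_rank (G\<lparr>carrier := F\<rparr>) 2 \<and>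
          (\<exists>Z. Z \<noteq> {} \<and> openin X Z \<and> translates \<phi> F Z = Z \<and>
            properly_discontinuous_on G X \<phi> F Z)"
  let ?ii = "\<exists>A Y a b. n_system G X \<phi> 3 A Y a b"
  let ?iii = "\<exists>A Y. openin X A \<and> A \<noteq> {} \<and> openin X Y \<and> Y \<noteq> {} \<and> A \<subseteq> Y \<and>
          (\<forall>n\<ge>3. \<exists>a b. n_system G X \<phi> n A Y a b)"
  let ?iv = "\<exists>f\<^sub>1 f\<^sub>2 U\<^sub>0 U1p U1m U2p U2m. ping_pong G X \<phi> f\<^sub>1 f\<^sub>2 U\<^sub>0 U1p U1m U2p U2m"
  \<comment> \<open>The equivalences follow from the cycle (i), (iii), (ii), (iv), (i).\<close>
  have "?iii" if ?i
    using that by (elim exE conjE) (rule homeomorphism_action.free_group_n_systems[OF H])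
  \<comment> \<open>This is the instance \<open>n = 3\<close>.\<close>
  moreover have "?ii" if ?iii
    using that by (metis order_refl)
  moreover have "?iv" if ?ii
    using that by (elim exE) (rule homeomorphism_action.three_system_ping_pong[OF H])
  moreover have "?i" if ?iv
    using that by (elim exE) (rule homeomorphism_action.ping_pong_properly_discontinuous[OF H])
  ultimately have ?equivalences
    unfolding Let_def by argo
  moreover have ?three
    unfolding Let_def
    by (intro allI impI) (erule homeomorphism_action.three_system_commutators_free[OF H _ HOL.refl])
  moreover have ?four
    unfolding Let_def
    by (intro allI impI) (erule homeomorphism_action.four_system_free[OF H _ HOL.refl])
  moreover have ?many
    unfolding Let_def
    by (intro allI impI)
      (rule homeomorphism_action.n_system_properly_discontinuous[OF H _ _ _ HOL.refl HOL.refl])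
  moreover have ?five
    by (intro allI impI) (erule homeomorphism_action.five_system_ping_pong[OF H])
  ultimately show ?thesis by blast
qed

end
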